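(* Let $X=V(f)\subset\mathbb P^N$ be a cubic hypersurface having vanishing hessian, not a cone, and with $\operatorname{codim}(Z)=1$, where $Z$ is the polar image of $X$. Suppose that the polar quadric $Q_p$ of a general point $p$ of $\mathbb P^N$ is tangent to a fixed linear space $L=\mathbb P^{N-\tau}$ along a common generator $M$, with $M=V(x_{\tau+1},\dots,x_N)$ and $L=V(x_{N-\tau+1},\dots,x_N)$, where $M\subseteq L$ and $L=\bigcap_{m\in M\setminus\operatorname{Vert}(Q_p)}T_mQ_p$. Then $$f=\sum_{i=0}^{\tau}x_iC^i(x_{N-\tau+1},\dots,x_N)+D(x_{\tau+1},\dots,x_N),\qquad(\ast)$$ where the $C^i$ are linearly independent quadratic forms depending only on the variables $x_{N-\tau+1},\dots,x_N$ and $D$ is a cubic form in the variables $x_{\tau+1},\dots,x_N$. Conversely, for every cubic hypersurface $X=V(f)\subset\mathbb P^N$ with $f$ as in $(\ast)$, the polar quadric of a general point of $\mathbb P^N$ is tangent to $V(x_{N-\tau+1},\dots,x_N)$ along the common generator $V(x_{\tau+1},\dots,x_N)$. Moreover, such a cubic hypersurface has vanishing hessian and $\operatorname{codim}(Z)=1$.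
   Context: The ground field $\mathbb K$ is algebraically closed of characteristic zero; hypersurfaces $X=V(f)\subset\mathbb P^N$ are reduced. $X$ has vanishing hessian if $\det\left[\frac{\partial^2f}{\partial x_i\partial x_j}\right]\equiv0$. $X$ is a cone if there is $p\in X$ with $\langle p,q\rangle\subset X$ (the line through $p$ and $q$) for all $q\in X$, $q\ne p$. The polar image is $Z=\overline{\Phi_X(\mathbb P^N)}\subset(\mathbb P^N)^*$, where $\Phi_X(p)=(\frac{\partial f}{\partial x_0}(p):\dots:\frac{\partial f}{\partial x_N}(p))$. The polar quadric $Q_p$ of $p\in\mathbb P^N$ is the quadric whose symmetric matrix is the Hessian matrix of $f$ at $p$. For a quadric $Q\subset\mathbb P^N$ of rank at least 3, $\operatorname{Vert}(Q)=\operatorname{Sing}Q$; a linear space $M=\mathbb P^\tau$, $\tau\ge1$, is a generator of $Q$ if $\operatorname{Vert}(Q)\subsetneq M\subset Q$. $T_mQ$ is the projective tangent space to $Q$ at $m$ (equal to $\mathbb P^N$ for $m\in\operatorname{Vert}(Q)$). If $L$ is a linear space containing a generator $M$ of $Q$, then $Q$ is tangent to $L$ along $M$ if $L\subseteq T_mQ$ for all $m\in M$. "Common" generator means that the same $M$ works for general $p$. Since $M\subseteq L$, one has $1\le\tau\le N-\tau$.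
   Formalization: The converse is false as stated (x0x4²+x1x4x5+x2x5², N=5, τ=2: codim Z=2); "generator" and codim(Z)=1 are proved only if the Jacobian of the C^i has generic rank τ and the Hessian of D in x_{τ+1},…,x_{N−τ} is generically invertible. *)

theory Defs
  imports
    "HOL-Library.Poly_Mapping"
    "HOL-Library.Extended_Nat"
    "HOL-Computational_Algebra.Squarefree"
    "HOL-Computational_Algebra.Polynomial"
    "Jordan_Normal_Form.DL_Rank"
begin

section \<open>Polynomials in the variables x_0, x_1, ...\<close>

text \<open>Multivariate polynomials are finitely supported maps from exponent vectors to
  coefficients; the ring structure (convolution product) is the one of the library.\<close>

type_synonym 'a mpoly = "(nat \<Rightarrow>\<^sub>0 nat) \<Rightarrow>\<^sub>0 'a"

definition Const :: "'a::zero \<Rightarrow> 'a mpoly" where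
  "Const c = Poly_Mapping.single 0 c"

definition Var :: "nat \<Rightarrow> 'a::zero_neq_one mpoly" where
  "Var i = Poly_Mapping.single (Poly_Mapping.single i 1) 1"

definition poly_vars :: "'a::zero mpoly \<Rightarrow> nat set" where
  "poly_vars g = (\<Union>m\<in>Poly_Mapping.keys g. Poly_Mapping.keys m)"

text \<open>Forms of degree \<open>d\<close> depending only on the variables with index in \<open>I\<close>; as usual the zero
  polynomial is a form of every degree.\<close>

definition is_form :: "nat set \<Rightarrow> nat \<Rightarrow> 'a::zero mpoly \<Rightarrow> bool" where
  "is_form I d g \<longleftrightarrow> poly_vars g \<subseteq> I \<and>
     (\<forall>m\<in>Poly_Mapping.keys g. (\<Sum>i\<in>Poly_Mapping.keys m. Poly_Mapping.lookup m i) = d)"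

definition eval :: "'a::comm_semiring_1 mpoly \<Rightarrow> 'a vec \<Rightarrow> 'a" where
  "eval g v = (\<Sum>m\<in>Poly_Mapping.keys g.
     Poly_Mapping.lookup g m * (\<Prod>i\<in>Poly_Mapping.keys m. (v $ i) ^ Poly_Mapping.lookup m i))"

definition pd :: "nat \<Rightarrow> 'a::comm_semiring_1 mpoly \<Rightarrow> 'a mpoly" where
  "pd i g = (\<Sum>m\<in>Poly_Mapping.keys g.
     Poly_Mapping.single (m - Poly_Mapping.single i 1)
       (of_nat (Poly_Mapping.lookup m i) * Poly_Mapping.lookup g m))"

section \<open>Projective space and its Zariski topology\<close>

text \<open>A point of P^N is given by any of its homogeneous coordinate vectors, a subset of P^N by the
  set of all homogeneous coordinate vectors of its points. Inclusions, unions and intersections of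
  subsets of P^N are then the ones of the representing sets. The dual space (P^N)^* is identified
  with P^N by the dual coordinates.\<close>

definition proj_space :: "nat \<Rightarrow> 'a::comm_semiring_1 vec set" where
  "proj_space N = carrier_vec (Suc N) - {0\<^sub>v (Suc N)}"

definition zeros :: "nat \<Rightarrow> 'a::comm_semiring_1 mpoly set \<Rightarrow> 'a vec set" where
  "zeros N F = {v \<in> proj_space N. \<forall>g\<in>F. eval g v = 0}"

definition zariski_closed :: "nat \<Rightarrow> 'a::comm_semiring_1 vec set \<Rightarrow> bool" where
  "zariski_closed N S \<longleftrightarrow> (\<exists>F. (\<forall>g\<in>F. \<exists>d. is_form {..N} d g) \<and> S = zeros N F)"

definition zariski_closure :: "nat \<Rightarrow> 'a::comm_semiring_1 vec set \<Rightarrow> 'a vec set" where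
  "zariski_closure N S = \<Inter>{T. zariski_closed N T \<and> S \<subseteq> T}"

definition irreducible_closed :: "nat \<Rightarrow> 'a::comm_semiring_1 vec set \<Rightarrow> bool" where
  "irreducible_closed N S \<longleftrightarrow> zariski_closed N S \<and> S \<noteq> {} \<and>
     (\<forall>A B. zariski_closed N A \<and> zariski_closed N B \<and> S = A \<union> B \<longrightarrow> A = S \<or> B = S)"

text \<open>Codimension in P^N of an irreducible closed subset \<open>Z\<close>: the supremum of the lengths of the
  chains of irreducible closed subsets that start with \<open>Z\<close>.\<close>

definition codim :: "nat \<Rightarrow> 'a::comm_semiring_1 vec set \<Rightarrow> enat" where
  "codim N Z = (SUP n \<in> {n. \<exists>W :: nat \<Rightarrow> 'a vec set. W 0 = Z \<and>
       (\<forall>i\<le>n. irreducible_closed N (W i)) \<and> (\<forall>i<n. W i \<subset> W (Suc i))}. enat n)"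

text \<open>\<open>P\<close> holds for the general point of P^N: it holds on a nonempty Zariski open set.\<close>

definition for_general :: "nat \<Rightarrow> ('a::comm_semiring_1 vec \<Rightarrow> bool) \<Rightarrow> bool" where
  "for_general N P \<longleftrightarrow>
     (\<exists>S. zariski_closed N S \<and> S \<noteq> proj_space N \<and> (\<forall>p\<in>proj_space N - S. P p))"

definition linear_space :: "nat \<Rightarrow> nat \<Rightarrow> 'a::field vec set \<Rightarrow> bool" where
  "linear_space N k M \<longleftrightarrow> (\<exists>B \<in> carrier_mat (Suc N) (Suc k). vec_space.rank (Suc N) B = Suc k \<and>
     M = {v \<in> proj_space N. \<exists>u \<in> carrier_vec (Suc k). v = B *\<^sub>v u})"

section \<open>Hypersurfaces\<close>

text \<open>\<open>V(f)\<close> is \<open>zeros N {f}\<close>. Squarefreeness of \<open>f\<close> means that \<open>V(f)\<close> is reduced, and it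
  implies that \<open>f\<close> is not zero.\<close>

definition cubic_hypersurface :: "nat \<Rightarrow> 'a::comm_ring_1 mpoly \<Rightarrow> bool" where
  "cubic_hypersurface N f \<longleftrightarrow> is_form {..N} 3 f \<and> squarefree f"

definition line :: "nat \<Rightarrow> 'a::comm_semiring_1 vec \<Rightarrow> 'a vec \<Rightarrow> 'a vec set" where
  "line N p q = {v \<in> proj_space N. \<exists>a b. v = a \<cdot>\<^sub>v p + b \<cdot>\<^sub>v q}"

definition is_cone :: "nat \<Rightarrow> 'a::comm_semiring_1 vec set \<Rightarrow> bool" where
  "is_cone N X \<longleftrightarrow> (\<exists>p\<in>X. \<forall>q\<in>X. (\<nexists>c. q = c \<cdot>\<^sub>v p) \<longrightarrow> line N p q \<subseteq> X)"

definition sing :: "nat \<Rightarrow> 'a::comm_semiring_1 mpoly \<Rightarrow> 'a vec set" where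
  "sing N f = {v \<in> zeros N {f}. \<forall>i\<le>N. eval (pd i f) v = 0}"

definition tangent_space :: "nat \<Rightarrow> 'a::comm_semiring_1 mpoly \<Rightarrow> 'a vec \<Rightarrow> 'a vec set" where
  "tangent_space N f m = {v \<in> proj_space N. (\<Sum>i\<le>N. eval (pd i f) m * v $ i) = 0}"

definition hessian :: "nat \<Rightarrow> 'a::comm_semiring_1 mpoly \<Rightarrow> 'a mpoly mat" where
  "hessian N f = mat (Suc N) (Suc N) (\<lambda>(i, j). pd i (pd j f))"

definition vanishing_hessian :: "nat \<Rightarrow> 'a::comm_ring_1 mpoly \<Rightarrow> bool" where
  "vanishing_hessian N f \<longleftrightarrow> det (hessian N f) = 0"

definition gradient :: "nat \<Rightarrow> 'a::comm_semiring_1 mpoly \<Rightarrow> 'a vec \<Rightarrow> 'a vec" where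
  "gradient N f p = vec (Suc N) (\<lambda>i. eval (pd i f) p)"

text \<open>The polar map is undefined where the gradient vanishes; the factor \<open>c\<close> runs through all the
  homogeneous coordinate vectors of the image point.\<close>

definition polar_image :: "nat \<Rightarrow> 'a::comm_semiring_1 mpoly \<Rightarrow> 'a vec set" where
  "polar_image N f = zariski_closure N
     {c \<cdot>\<^sub>v gradient N f p | c p. c \<noteq> 0 \<and> p \<in> proj_space N \<and> gradient N f p \<noteq> 0\<^sub>v (Suc N)}"

section \<open>Quadrics\<close>

text \<open>A quadric is given by its symmetric matrix \<open>A\<close>. A different choice of homogeneous coordinates
  of \<open>p\<close> only rescales the matrix of the polar quadric of a cubic.\<close>

definition polar_quadric :: "nat \<Rightarrow> 'a::comm_semiring_1 mpoly \<Rightarrow> 'a vec \<Rightarrow> 'a mat" where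
  "polar_quadric N f p = map_mat (\<lambda>g. eval g p) (hessian N f)"

definition quadratic_form :: "nat \<Rightarrow> 'a::comm_semiring_1 mat \<Rightarrow> 'a mpoly" where
  "quadratic_form N A = (\<Sum>i\<le>N. \<Sum>j\<le>N. Const (A $$ (i, j)) * Var i * Var j)"

definition quadric :: "nat \<Rightarrow> 'a::comm_semiring_1 mat \<Rightarrow> 'a vec set" where
  "quadric N A = zeros N {quadratic_form N A}"

definition Vert :: "nat \<Rightarrow> 'a::comm_semiring_1 mat \<Rightarrow> 'a vec set" where
  "Vert N A = sing N (quadratic_form N A)"

definition quadric_tangent_space ::
    "nat \<Rightarrow> 'a::comm_semiring_1 mat \<Rightarrow> 'a vec \<Rightarrow> 'a vec set" where
  "quadric_tangent_space N A m = tangent_space N (quadratic_form N A) m"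

text \<open>Generators are considered for quadrics of rank at least 3 only.\<close>

definition generator :: "nat \<Rightarrow> 'a::field mat \<Rightarrow> 'a vec set \<Rightarrow> bool" where
  "generator N A M \<longleftrightarrow> vec_space.rank (Suc N) A \<ge> 3 \<and> (\<exists>k\<ge>1. linear_space N k M) \<and>
     Vert N A \<subset> M \<and> M \<subseteq> quadric N A"

definition tangent_along ::
    "nat \<Rightarrow> 'a::field mat \<Rightarrow> 'a vec set \<Rightarrow> 'a vec set \<Rightarrow> bool" where
  "tangent_along N A L M \<longleftrightarrow> (\<exists>k. linear_space N k L) \<and> M \<subseteq> L \<and>
     (\<forall>m\<in>M. L \<subseteq> quadric_tangent_space N A m)"

section \<open>The normal form\<close>

definition normal_form ::
    "nat \<Rightarrow> nat \<Rightarrow> 'a::comm_ring_1 mpoly \<Rightarrow> (nat \<Rightarrow> 'a mpoly) \<Rightarrow> 'a mpoly \<Rightarrow> bool" where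
  "normal_form N \<tau> f C D \<longleftrightarrow>
     (\<forall>i\<le>\<tau>. is_form {N - \<tau> + 1..N} 2 (C i)) \<and>
     (\<forall>c. (\<Sum>i\<le>\<tau>. Const (c i) * C i) = 0 \<longrightarrow> (\<forall>i\<le>\<tau>. c i = 0)) \<and>
     is_form {\<tau> + 1..N} 3 D \<and>
     f = (\<Sum>i\<le>\<tau>. Var i * C i) + D"

text \<open>A cubic in normal form has Hessian matrix
  [0, 0, J; 0, H, *; J^T, *, *] in blocks of sizes \<open>\<tau> + 1\<close>, \<open>N - 2 \<tau>\<close>, \<open>\<tau>\<close>, where J is the
  Jacobian matrix of the \<open>C i\<close> and H the Hessian matrix of \<open>D\<close> with respect to the middle variables
  x_(\<tau>+1), ..., x_(N-\<tau>). The following condition, satisfied by general \<open>C\<close> and \<open>D\<close> when \<open>\<tau> \<ge> 2\<close>,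
  says that J and H have maximal rank at the general point, i.e. that the general Hessian matrix
  has rank \<open>N\<close>. It does not follow from the normal form:
  x_0 x_4^2 + x_1 x_4 x_5 + x_2 x_5^2 (\<open>N = 5\<close>, \<open>\<tau> = 2\<close>, \<open>D = 0\<close>) does not involve x_3, so that the
  vertex of every polar quadric contains (0:0:0:1:0:0), which is not in V(x_3, x_4, x_5), and the
  polar image has codimension 2. The non-cone
  x_0 x_5^2 + x_1 x_6^2 + x_2 x_7^2 + x_3 x_5 x_6 + x_4 x_5 x_7 (\<open>N = 7\<close>, \<open>\<tau> = 3\<close>, \<open>D\<close> the last
  summand) shows the same behaviour.\<close>

definition nondegenerate ::
    "nat \<Rightarrow> nat \<Rightarrow> (nat \<Rightarrow> 'a::field mpoly) \<Rightarrow> 'a mpoly \<Rightarrow> bool" where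
  "nondegenerate N \<tau> C D \<longleftrightarrow> for_general N (\<lambda>p.
     vec_space.rank (Suc \<tau>) (mat (Suc \<tau>) \<tau> (\<lambda>(i, j). eval (pd (N - \<tau> + 1 + j) (C i)) p)) = \<tau> \<and>
     det (mat (N - 2 * \<tau>) (N - 2 * \<tau>)
       (\<lambda>(i, j). eval (pd (\<tau> + 1 + i) (pd (\<tau> + 1 + j) D)) p)) \<noteq> 0)"

end

theory Submission
  imports Defs
begin

text \<open>
  Write \<open>A(p)\<close> for the matrix of the polar quadric, that is, for the Hessian matrix of \<open>f\<close> at \<open>p\<close>.
  Evaluating the bilinear form of \<open>A(p)\<close> on coordinate vectors shows that the polar quadric is tangent
  to \<open>L\<close> along \<open>M\<close> exactly if the entries of \<open>A(p)\<close> with row index at most \<open>\<tau>\<close> and column index at most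
  \<open>N - \<tau>\<close> vanish (\<open>tangent_zero_block\<close>, \<open>zero_block_tangent\<close>). If this holds for general \<open>p\<close>, then
  \<open>\<partial>\<^sub>i \<partial>\<^sub>j f = 0\<close> for these \<open>i\<close> and \<open>j\<close>, and the normal form follows with \<open>C i = \<partial>\<^sub>i f\<close> and
  \<open>D = f - \<Sum> x_i C i\<close>. A linear relation \<open>\<Sum> c_i C i = 0\<close> would make \<open>V(f)\<close> a cone with vertex
  \<open>(c_0 : ... : c_\<tau> : 0 : ... : 0)\<close> (\<open>ex_normal_form\<close>).

  Conversely the normal form forces the block of zeros. It has \<open>\<tau> + 1\<close> rows and \<open>N - \<tau> + 1\<close> columns,
  and \<open>(\<tau> + 1) + (N - \<tau> + 1)\<close> exceeds the size \<open>N + 1\<close> of the matrix, so the determinant vanishes.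
  At a point where the Jacobian matrix \<open>J\<close> of \<open>C\<close> and the middle block of the Hessian matrix of \<open>D\<close> have
  maximal rank, the three block rows of \<open>A(p) u = 0\<close> show successively that the last \<open>\<tau>\<close> and the middle
  coordinates of \<open>u\<close> vanish and that \<open>u\<close> is a left kernel vector of \<open>J\<close>. For a suitable \<open>k \<le> \<tau>\<close> such a
  vector is zero as soon as its coordinate with index \<open>k\<close> is (\<open>nf_kernel_trivial\<close>). Hence the vertex is
  properly contained in \<open>M\<close>, and the \<open>N\<close> columns of \<open>A(p)\<close> with index different from \<open>k\<close> are linearly
  independent. A single variable does not admit two linearly independent quadratic forms, so that \<open>\<tau> \<ge> 2\<close>
  and \<open>N \<ge> 4\<close>, and the rank is at least 3 (\<open>nf_generator\<close>).

  The codimension of the polar image \<open>Z\<close> needs three facts. First, \<open>Z\<close> and the whole projective space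
  are irreducible, because the product of two nonzero polynomial functions is nonzero. Second, \<open>Z\<close> is not the
  whole space: the \<open>\<tau> + 1\<close> forms \<open>C i\<close> in \<open>\<tau>\<close> variables are algebraically dependent by a count of monomials
  (\<open>ex_algebraic_relation\<close>), and they are the first \<open>\<tau> + 1\<close> coordinates of the polar map. Third, no irreducible
  closed set lies strictly between. By the Jacobian criterion, the partial derivatives
  \<open>\<partial>\<^sub>i f\<close> with \<open>i \<noteq> k\<close> are algebraically independent, that is, the ideal of \<open>Z\<close> contains no nonzero polynomial
  in the variables other than \<open>x_k\<close> (\<open>jacobian_criterion\<close>). Over the ring of these polynomials,
  pseudo-division in the one remaining variable \<open>x_k\<close> shows that a nonzero prime ideal contained in the
  ideal of \<open>Z\<close> is equal to it (\<open>no_intermediate_prime\<close>).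
\<close>

section \<open>Substitution into polynomials\<close>

text \<open>Induction over the monomials of a polynomial in the variables with index in \<open>I\<close>.\<close>

lemma mpoly_add_induct [consumes 1, case_names single add]:
  assumes "poly_vars g \<subseteq> I"
    and "\<And>m c. Poly_Mapping.keys m \<subseteq> I \<Longrightarrow> P (Poly_Mapping.single m c)"
    and "\<And>f g. P f \<Longrightarrow> P g \<Longrightarrow> P (f + g)"
  shows "P (g :: 'a::comm_ring_1 mpoly)"
proof -
  have P0: "P 0"
    using assms(2)[of 0 0] by simp
  have *: "P (\<Sum>m\<in>A. Poly_Mapping.single m (Poly_Mapping.lookup g m))"
    if "A \<subseteq> Poly_Mapping.keys g" for A
    using finite_subset[OF that finite_keys] that
  proof (induction A rule: finite_induct)
    case empty
    then show ?case using P0 by simp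
  next
    case (insert m A)
    have "P (Poly_Mapping.single m (Poly_Mapping.lookup g m))"
      by (rule assms(2)) (use insert assms(1) in \<open>auto simp: poly_vars_def\<close>)
    then show ?case using insert assms(3) by simp
  qed
  have "g = (\<Sum>m\<in>Poly_Mapping.keys g. Poly_Mapping.single m (Poly_Mapping.lookup g m))"
  proof (rule poly_mapping_eqI)
    fix k
    have "(\<Sum>x\<in>Poly_Mapping.keys g. if x = k then Poly_Mapping.lookup g x else 0)
        = Poly_Mapping.lookup g k"
      by (auto simp: sum.delta in_keys_iff)
    then show "Poly_Mapping.lookup g k = Poly_Mapping.lookup
        (\<Sum>m\<in>Poly_Mapping.keys g. Poly_Mapping.single m (Poly_Mapping.lookup g m)) k"
      by (simp add: lookup_sum lookup_single when_def)
  qed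
  then show ?thesis using *[of "Poly_Mapping.keys g"] by simp
qed

lemma keys_add_nat:
  "Poly_Mapping.keys (m + m' :: nat \<Rightarrow>\<^sub>0 nat) = Poly_Mapping.keys m \<union> Poly_Mapping.keys m'"
  by (auto simp: in_keys_iff lookup_add)

text \<open>The value of the monomial with exponent vector \<open>m\<close> when \<open>\<phi> i\<close> is substituted for the
  variable with index \<open>i\<close>.\<close>

definition mon_eval :: "(nat \<Rightarrow> 'b::comm_ring_1) \<Rightarrow> (nat \<Rightarrow>\<^sub>0 nat) \<Rightarrow> 'b" where
  "mon_eval \<phi> m = (\<Prod>i\<in>Poly_Mapping.keys m. \<phi> i ^ Poly_Mapping.lookup m i)"

text \<open>Substitution of elements \<open>\<phi> i\<close> of a commutative ring for the variables, where the coefficients are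
  mapped by \<open>\<kappa>\<close>. Instances are evaluation at a point (\<open>\<kappa>\<close> the identity), restriction to a line
  (\<open>\<kappa>\<close> the constants of the univariate polynomials) and composition of polynomials (\<open>\<kappa> = Const\<close>).
  It is a ring homomorphism if \<open>\<kappa>\<close> is one.\<close>

definition psubst :: "('a \<Rightarrow> 'b) \<Rightarrow> (nat \<Rightarrow> 'b::comm_ring_1) \<Rightarrow> 'a::comm_ring_1 mpoly \<Rightarrow> 'b" where
  "psubst \<kappa> \<phi> g = (\<Sum>m\<in>Poly_Mapping.keys g. \<kappa> (Poly_Mapping.lookup g m) * mon_eval \<phi> m)"

lemma eval_eq_psubst: "eval g v = psubst (\<lambda>c. c) (\<lambda>i. v $ i) g"
  by (simp add: eval_def psubst_def mon_eval_def)

lemma mon_eval_superset: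
  assumes "finite S" "Poly_Mapping.keys m \<subseteq> S"
  shows "mon_eval \<phi> m = (\<Prod>i\<in>S. \<phi> i ^ Poly_Mapping.lookup m i)"
  unfolding mon_eval_def by (rule prod.mono_neutral_left) (use assms in \<open>auto simp: in_keys_iff\<close>)

lemma mon_eval_0 [simp]: "mon_eval \<phi> 0 = 1"
  by (simp add: mon_eval_def)

lemma mon_eval_add: "mon_eval \<phi> (m + m') = mon_eval \<phi> m * mon_eval \<phi> m'"
proof -
  let ?S = "Poly_Mapping.keys m \<union> Poly_Mapping.keys m'"
  have *: "mon_eval \<phi> k = (\<Prod>i\<in>?S. \<phi> i ^ Poly_Mapping.lookup k i)"
    if "Poly_Mapping.keys k \<subseteq> ?S" for k
    by (rule mon_eval_superset) (use that in auto)
  have "mon_eval \<phi> (m + m') = (\<Prod>i\<in>?S. \<phi> i ^ Poly_Mapping.lookup (m + m') i)"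
    by (rule *) (simp add: keys_add_nat)
  also have "\<dots> = mon_eval \<phi> m * mon_eval \<phi> m'"
    by (simp add: * lookup_add power_add prod.distrib)
  finally show ?thesis .
qed

lemma mon_eval_single: "mon_eval \<phi> (Poly_Mapping.single i n) = \<phi> i ^ n"
  by (simp add: mon_eval_def)

lemma Const_0 [simp]: "Const 0 = 0"
  by (simp add: Const_def)

lemma Const_1 [simp]: "Const 1 = 1"
  by (simp add: Const_def)

lemma Const_add: "Const (a + b) = Const a + Const b"
  by (simp add: Const_def single_add)

lemma Const_mult: "Const (a * b) = Const a * Const b"
  by (simp add: Const_def mult_single)

lemma Const_mult_single: "Const a * Poly_Mapping.single m b = Poly_Mapping.single m (a * b)"
  by (simp add: Const_def mult_single)

lemma lookup_Const_mult: "Poly_Mapping.lookup (Const (a::'a::comm_ring_1) * g) m = a * Poly_Mapping.lookup g m"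
  by (subst Const_def, subst mult_map_scale_conv_mult[symmetric]) (simp add: map.rep_eq when_def)

lemma comm_ring_hom_Const: "comm_ring_hom (Const :: 'a::comm_ring_1 \<Rightarrow> 'a mpoly)"
  by unfold_locales (simp_all add: Const_add Const_mult)

lemma Var_power: "(Var i :: 'a::comm_ring_1 mpoly) ^ n = Poly_Mapping.single (Poly_Mapping.single i n) 1"
proof (induction n)
  case (Suc n)
  then show ?case by (simp add: Var_def mult_single single_add[symmetric])
qed simp

lemma single_eq_Const_Var:
  "Poly_Mapping.single m (c::'a::comm_ring_1) = Const c * (\<Prod>i\<in>Poly_Mapping.keys m. Var i ^ Poly_Mapping.lookup m i)"
proof -
  have *: "(\<Prod>i\<in>A. (Var i :: 'a mpoly) ^ Poly_Mapping.lookup m i)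
      = Poly_Mapping.single (\<Sum>i\<in>A. Poly_Mapping.single i (Poly_Mapping.lookup m i)) 1"
    if "finite A" for A
    using that by (induction A rule: finite_induct) (simp_all add: Var_power mult_single)
  have "(\<Sum>i\<in>Poly_Mapping.keys m. Poly_Mapping.single i (Poly_Mapping.lookup m i)) = m"
    by (rule poly_mapping_eqI) (auto simp: lookup_sum lookup_single when_def sum.delta' in_keys_iff)
  then show ?thesis by (simp add: * Const_mult_single)
qed

text \<open>Induction over the ring structure: the polynomials in the variables with index in \<open>I\<close> are
  generated by the constants and these variables.\<close>

lemma mpoly_ring_induct [consumes 1, case_names Const Var add mult]:
  assumes g: "poly_vars g \<subseteq> I"
    and C: "\<And>c. P (Const c)" and V: "\<And>i. i \<in> I \<Longrightarrow> P (Var i)"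
    and A: "\<And>f g. P f \<Longrightarrow> P g \<Longrightarrow> P (f + g)" and M: "\<And>f g. P f \<Longrightarrow> P g \<Longrightarrow> P (f * g)"
  shows "P (g :: 'a::comm_ring_1 mpoly)"
proof (rule mpoly_add_induct[where P = P and I = I and g = g])
  fix m :: "nat \<Rightarrow>\<^sub>0 nat" and c :: 'a assume m: "Poly_Mapping.keys m \<subseteq> I"
  have P1: "P 1" using C[of 1] by simp
  have pow: "P (Var i ^ n)" if "i \<in> I" for i n
    by (induction n) (use P1 V M that in auto)
  have "P (\<Prod>i\<in>A. Var i ^ Poly_Mapping.lookup m i)" if "A \<subseteq> Poly_Mapping.keys m" for A
    using finite_subset[OF that finite_keys] that
    by (induction A rule: finite_induct) (use P1 pow M m in auto)
  then show "P (Poly_Mapping.single m c)"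
    unfolding single_eq_Const_Var using M C by blast
qed (use A g in auto)

context comm_ring_hom begin

lemma psubst_superset:
  assumes "finite K" "Poly_Mapping.keys g \<subseteq> K"
  shows "psubst hom \<phi> g = (\<Sum>m\<in>K. hom (Poly_Mapping.lookup g m) * mon_eval \<phi> m)"
  unfolding psubst_def
  by (rule sum.mono_neutral_left) (use assms in \<open>auto simp: in_keys_iff\<close>)

lemma psubst_single: "psubst hom \<phi> (Poly_Mapping.single m c) = hom c * mon_eval \<phi> m"
  by (simp add: psubst_def)

lemma psubst_add: "psubst hom \<phi> (f + g) = psubst hom \<phi> f + psubst hom \<phi> g"
proof -
  let ?K = "Poly_Mapping.keys f \<union> Poly_Mapping.keys g"
  have *: "psubst hom \<phi> h = (\<Sum>m\<in>?K. hom (Poly_Mapping.lookup h m) * mon_eval \<phi> m)"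
    if "Poly_Mapping.keys h \<subseteq> ?K" for h
    by (rule psubst_superset) (use that in auto)
  show ?thesis
    by (simp add: * keys_add lookup_add hom_add distrib_right sum.distrib)
qed

lemma psubst_mult: "psubst hom \<phi> (f * g) = psubst hom \<phi> f * psubst hom \<phi> g"
proof (rule mpoly_add_induct[where g = f and I = UNIV])
  fix m c
  show "psubst hom \<phi> (Poly_Mapping.single m c * g) = psubst hom \<phi> (Poly_Mapping.single m c) * psubst hom \<phi> g"
  proof (rule mpoly_add_induct[where g = g and I = UNIV])
    fix m' c'
    show "psubst hom \<phi> (Poly_Mapping.single m c * Poly_Mapping.single m' c') =
      psubst hom \<phi> (Poly_Mapping.single m c) * psubst hom \<phi> (Poly_Mapping.single m' c')"
      by (simp add: mult_single psubst_single mon_eval_add hom_mult mult_ac)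
  qed (simp_all add: psubst_add distrib_left)
qed (simp_all add: psubst_add distrib_right)

lemma psubst_Const: "psubst hom \<phi> (Const c) = hom c"
  by (simp add: Const_def psubst_single)

lemma psubst_Var: "psubst hom \<phi> (Var i) = \<phi> i"
  by (simp add: Var_def psubst_single mon_eval_single)

lemma comm_ring_hom_psubst: "comm_ring_hom (psubst hom \<phi>)"
  using psubst_Const[of _ 0] psubst_Const[of _ 1]
  by unfold_locales (simp_all add: psubst_add psubst_mult)

end

lemma comm_ring_hom_ident: "comm_ring_hom (\<lambda>c::'a::comm_ring_1. c)"
  by unfold_locales simp_all

lemma comm_ring_hom_eval: "comm_ring_hom (\<lambda>g. eval g (v :: 'a::comm_ring_1 vec))"
  unfolding eval_eq_psubst by (rule comm_ring_hom.comm_ring_hom_psubst[OF comm_ring_hom_ident])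

interpretation eval: comm_ring_hom "\<lambda>g. eval g (v :: 'a::comm_ring_1 vec)" for v
  by (rule comm_ring_hom_eval)

lemma eval_Const [simp]: "eval (Const c) (v :: 'a::comm_ring_1 vec) = c"
  unfolding eval_eq_psubst by (rule comm_ring_hom.psubst_Const[OF comm_ring_hom_ident])

lemma eval_Var [simp]: "eval (Var i) (v :: 'a::comm_ring_1 vec) = v $ i"
  unfolding eval_eq_psubst by (rule comm_ring_hom.psubst_Var[OF comm_ring_hom_ident])

section \<open>Partial derivatives\<close>

lemma pd_superset:
  assumes "finite K" "Poly_Mapping.keys g \<subseteq> K"
  shows "pd i (g :: 'a::comm_ring_1 mpoly) = (\<Sum>m\<in>K. Poly_Mapping.single (m - Poly_Mapping.single i 1)
       (of_nat (Poly_Mapping.lookup m i) * Poly_Mapping.lookup g m))"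
  unfolding pd_def
  by (rule sum.mono_neutral_left) (use assms in \<open>auto simp: in_keys_iff\<close>)

lemma pd_add: "pd i (f + g :: 'a::comm_ring_1 mpoly) = pd i f + pd i g"
proof -
  let ?K = "Poly_Mapping.keys f \<union> Poly_Mapping.keys g"
  have *: "pd i h = (\<Sum>m\<in>?K. Poly_Mapping.single (m - Poly_Mapping.single i 1)
       (of_nat (Poly_Mapping.lookup m i) * Poly_Mapping.lookup h m))"
    if "Poly_Mapping.keys h \<subseteq> ?K" for h :: "'a mpoly"
    by (rule pd_superset) (use that in auto)
  show ?thesis
    by (simp add: * keys_add lookup_add distrib_left single_add sum.distrib)
qed

lemma pd_single: "pd i (Poly_Mapping.single m (c :: 'a::comm_ring_1)) =
    Poly_Mapping.single (m - Poly_Mapping.single i 1) (of_nat (Poly_Mapping.lookup m i) * c)"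
  by (simp add: pd_def)

lemma pd_0 [simp]: "pd i (0 :: 'a::comm_ring_1 mpoly) = 0"
  by (simp add: pd_def)

lemma pd_Const [simp]: "pd i (Const (c :: 'a::comm_ring_1)) = 0"
  by (simp add: Const_def pd_single)

lemma pd_Var: "pd i (Var j :: 'a::comm_ring_1 mpoly) = (if i = j then 1 else 0)"
  by (auto simp: Var_def pd_single lookup_single)

lemma pd_mult: "pd i (f * g :: 'a::comm_ring_1 mpoly) = pd i f * g + f * pd i g"
proof (rule mpoly_add_induct[where g = f and I = UNIV])
  fix m and c :: 'a
  show "pd i (Poly_Mapping.single m c * g) = pd i (Poly_Mapping.single m c) * g + Poly_Mapping.single m c * pd i g"
  proof (rule mpoly_add_induct[where g = g and I = UNIV])
    fix m' and c' :: 'a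
    let ?e = "Poly_Mapping.single i (1::nat)"
    have 1: "m + m' - ?e = (m - ?e) + m'" if "Poly_Mapping.lookup m i > 0" for m m'
      by (rule poly_mapping_eqI) (use that in \<open>auto simp: lookup_add lookup_minus lookup_single when_def\<close>)
    have A: "Poly_Mapping.single ((m - ?e) + m') (of_nat (Poly_Mapping.lookup m i) * x)
        = Poly_Mapping.single (m + m' - ?e) (of_nat (Poly_Mapping.lookup m i) * x)" for m m' and x :: 'a
      using 1[of m m'] by (cases "Poly_Mapping.lookup m i = 0") simp_all
    show "pd i (Poly_Mapping.single m c * Poly_Mapping.single m' c') =
      pd i (Poly_Mapping.single m c) * Poly_Mapping.single m' c' +
      Poly_Mapping.single m c * pd i (Poly_Mapping.single m' c')"
      using A[of m m' "c * c'"] A[of m' m "c * c'"]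
      by (simp add: mult_single pd_single lookup_add distrib_right single_add add.commute[of m m'] add.commute[of m "m' - _"] mult.assoc mult.left_commute[of c])
  qed (simp_all add: pd_add distrib_left)
qed (simp_all add: pd_add distrib_right)

lemma pd_uminus: "pd i (- g :: 'a::comm_ring_1 mpoly) = - pd i g"
  using pd_add[of i g "- g"] by (simp add: eq_neg_iff_add_eq_0 add.commute)

lemma pd_diff: "pd i (f - g :: 'a::comm_ring_1 mpoly) = pd i f - pd i g"
  using pd_add[of i f "- g"] by (simp add: pd_uminus)

lemma pd_sum: "pd i (\<Sum>x\<in>A. f x :: 'a::comm_ring_1 mpoly) = (\<Sum>x\<in>A. pd i (f x))"
  by (induction A rule: infinite_finite_induct) (simp_all add: pd_add)

lemma pd_commute: "pd i (pd j (g :: 'a::comm_ring_1 mpoly)) = pd j (pd i g)"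
  by (rule mpoly_ring_induct[where g = g and I = UNIV])
    (auto simp: pd_add pd_mult pd_Var algebra_simps Const_1[symmetric] simp del: Const_1)

text \<open>The chain rule for a derivation \<open>\<delta>\<close> of the target ring that vanishes on the constants. It is applied
  to the derivative of univariate polynomials and to the partial derivatives.\<close>

lemma chain_rule:
  assumes \<kappa>: "comm_ring_hom \<kappa>"
    and dadd: "\<And>a b. \<delta> (a + b) = \<delta> a + \<delta> b" and dmult: "\<And>a b. \<delta> (a * b) = \<delta> a * b + a * \<delta> b"
    and d\<kappa>: "\<And>c. \<delta> (\<kappa> c) = 0"
    and g: "poly_vars g \<subseteq> {..N}"
  shows "\<delta> (psubst \<kappa> \<phi> g) = (\<Sum>i\<le>N. psubst \<kappa> \<phi> (pd i g) * \<delta> (\<phi> i))"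
proof -
  interpret \<kappa>: comm_ring_hom \<kappa> by (rule \<kappa>)
  interpret ps: comm_ring_hom "psubst \<kappa> \<phi>" by (rule \<kappa>.comm_ring_hom_psubst)
  show ?thesis
    using g
  proof (rule mpoly_ring_induct[where I = "{..N}"])
    fix j assume "j \<in> {..N}"
    have "psubst \<kappa> \<phi> (pd i (Var j)) * \<delta> (\<phi> i) = (if i = j then \<delta> (\<phi> j) else 0)" for i
      by (simp add: pd_Var)
    then show "\<delta> (psubst \<kappa> \<phi> (Var j)) = (\<Sum>i\<le>N. psubst \<kappa> \<phi> (pd i (Var j)) * \<delta> (\<phi> i))"
      using \<open>j \<in> {..N}\<close> by (simp add: \<kappa>.psubst_Var)
  qed (simp_all add: \<kappa>.psubst_Const d\<kappa> dadd dmult pd_add pd_mult ps.hom_add ps.hom_mult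
      algebra_simps sum.distrib sum_distrib_left sum_distrib_right)
qed

section \<open>Variables, degrees and forms\<close>

lemma poly_vars_0 [simp]: "poly_vars 0 = {}"
  by (simp add: poly_vars_def)

lemma poly_vars_1 [simp]: "poly_vars (1 :: 'a::comm_ring_1 mpoly) = {}"
  by (simp add: poly_vars_def)

lemma poly_vars_Const [simp]: "poly_vars (Const c) = {}"
  by (simp add: poly_vars_def Const_def)

lemma poly_vars_Var: "poly_vars (Var i :: 'a::comm_ring_1 mpoly) = {i}"
  by (simp add: poly_vars_def Var_def)

lemma poly_vars_add: "poly_vars (f + g :: 'a::comm_ring_1 mpoly) \<subseteq> poly_vars f \<union> poly_vars g"
  using keys_add[of f g] by (auto simp: poly_vars_def)

lemma poly_vars_uminus [simp]: "poly_vars (- f :: 'a::comm_ring_1 mpoly) = poly_vars f"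
  by (auto simp: poly_vars_def in_keys_iff)

lemma poly_vars_mult: "poly_vars (f * g :: 'a::comm_ring_1 mpoly) \<subseteq> poly_vars f \<union> poly_vars g"
proof
  fix i assume "i \<in> poly_vars (f * g)"
  then obtain m where "m \<in> Poly_Mapping.keys (f * g)" "i \<in> Poly_Mapping.keys m"
    by (auto simp: poly_vars_def)
  moreover from this obtain a b where "m = a + b" "a \<in> Poly_Mapping.keys f" "b \<in> Poly_Mapping.keys g"
    using keys_mult[of f g] by blast
  ultimately show "i \<in> poly_vars f \<union> poly_vars g"
    by (auto simp: poly_vars_def keys_add_nat)
qed

lemma poly_vars_diff: "poly_vars (f - g :: 'a::comm_ring_1 mpoly) \<subseteq> poly_vars f \<union> poly_vars g"
  using poly_vars_add[of f "- g"] by simp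

lemma poly_vars_sum: "poly_vars (\<Sum>x\<in>A. f x :: 'a::comm_ring_1 mpoly) \<subseteq> (\<Union>x\<in>A. poly_vars (f x))"
  by (induction A rule: infinite_finite_induct) (auto dest!: subsetD[OF poly_vars_add])

lemma poly_vars_pd: "poly_vars (pd i g :: 'a::comm_ring_1 mpoly) \<subseteq> poly_vars g"
proof -
  have "poly_vars (Poly_Mapping.single (m - Poly_Mapping.single i 1)
       (of_nat (Poly_Mapping.lookup m i) * Poly_Mapping.lookup g m)) \<subseteq> poly_vars g"
    if "m \<in> Poly_Mapping.keys g" for m
  proof -
    have "Poly_Mapping.keys (m - Poly_Mapping.single i 1) \<subseteq> Poly_Mapping.keys m"
      by (auto simp: in_keys_iff lookup_minus)
    then show ?thesis using that by (auto simp: poly_vars_def)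
  qed
  then show ?thesis unfolding pd_def using poly_vars_sum by blast
qed

lemma pd_eq_0_if_notin_vars: "i \<notin> poly_vars g \<Longrightarrow> pd i (g :: 'a::comm_ring_1 mpoly) = 0"
  by (auto simp: pd_def poly_vars_def in_keys_iff intro!: sum.neutral)

text \<open>The total degree of the monomial with exponent vector \<open>m\<close>.\<close>

definition mdeg :: "(nat \<Rightarrow>\<^sub>0 nat) \<Rightarrow> nat" where
  "mdeg m = (\<Sum>i\<in>Poly_Mapping.keys m. Poly_Mapping.lookup m i)"

lemma mdeg_superset: "finite S \<Longrightarrow> Poly_Mapping.keys m \<subseteq> S \<Longrightarrow> mdeg m = (\<Sum>i\<in>S. Poly_Mapping.lookup m i)"
  unfolding mdeg_def by (rule sum.mono_neutral_left) (auto simp: in_keys_iff)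

lemma mdeg_0 [simp]: "mdeg 0 = 0"
  by (simp add: mdeg_def)

lemma mdeg_single [simp]: "mdeg (Poly_Mapping.single i n) = n"
  by (simp add: mdeg_def)

lemma mdeg_add: "mdeg (m + m') = mdeg m + mdeg m'"
  using mdeg_superset[of "Poly_Mapping.keys m \<union> Poly_Mapping.keys m'" m]
    mdeg_superset[of "Poly_Mapping.keys m \<union> Poly_Mapping.keys m'" m']
    mdeg_superset[of "Poly_Mapping.keys m \<union> Poly_Mapping.keys m'" "m + m'"]
  by (simp add: keys_add_nat lookup_add sum.distrib)

lemma is_form_iff: "is_form I d g \<longleftrightarrow> poly_vars g \<subseteq> I \<and> (\<forall>m\<in>Poly_Mapping.keys g. mdeg m = d)"
  by (simp add: is_form_def mdeg_def)

lemma is_form_0 [simp]: "is_form I d 0"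
  by (simp add: is_form_iff)

lemma is_form_mono: "is_form I d g \<Longrightarrow> I \<subseteq> J \<Longrightarrow> is_form J d g"
  by (auto simp: is_form_iff)

lemma is_form_Const: "is_form I 0 (Const c)"
  by (simp add: is_form_iff) (simp add: Const_def)

lemma is_form_Var: "i \<in> I \<Longrightarrow> is_form I 1 (Var i :: 'a::comm_ring_1 mpoly)"
  by (simp add: is_form_iff poly_vars_Var) (simp add: Var_def)

lemma is_form_add: "is_form I d f \<Longrightarrow> is_form I d g \<Longrightarrow> is_form I d (f + g :: 'a::comm_ring_1 mpoly)"
  using poly_vars_add[of f g] keys_add[of f g] by (auto simp: is_form_iff)

lemma is_form_uminus: "is_form I d g \<Longrightarrow> is_form I d (- g :: 'a::comm_ring_1 mpoly)"
  by (auto simp: is_form_iff in_keys_iff)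

lemma is_form_diff: "is_form I d f \<Longrightarrow> is_form I d g \<Longrightarrow> is_form I d (f - g :: 'a::comm_ring_1 mpoly)"
  using is_form_add[of I d f "- g"] is_form_uminus[of I d g] by simp

lemma is_form_mult: "is_form I d f \<Longrightarrow> is_form I e g \<Longrightarrow> is_form I (d + e) (f * g :: 'a::comm_ring_1 mpoly)"
  using poly_vars_mult[of f g] keys_mult[of f g] unfolding is_form_iff
  by (intro conjI ballI) (auto dest!: subsetD simp: mdeg_add)

lemma is_form_sum: "(\<And>x. x \<in> A \<Longrightarrow> is_form I d (f x)) \<Longrightarrow> is_form I d (\<Sum>x\<in>A. f x :: 'a::comm_ring_1 mpoly)"
  by (induction A rule: infinite_finite_induct) (auto intro: is_form_add)

lemma keys_pdE:
  assumes "m \<in> Poly_Mapping.keys (pd i (g :: 'a::comm_ring_1 mpoly))"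
  obtains k where "k \<in> Poly_Mapping.keys g" "k = m + Poly_Mapping.single i 1"
proof -
  from assms have "\<exists>k\<in>Poly_Mapping.keys g. m \<in> Poly_Mapping.keys (Poly_Mapping.single
      (k - Poly_Mapping.single i 1) (of_nat (Poly_Mapping.lookup k i) * Poly_Mapping.lookup g k))"
    unfolding pd_def in_keys_iff[of m] lookup_sum
    by (auto dest: sum.not_neutral_contains_not_neutral)
  then obtain k where k: "k \<in> Poly_Mapping.keys g" "m = k - Poly_Mapping.single i 1"
      "of_nat (Poly_Mapping.lookup k i) * Poly_Mapping.lookup g k \<noteq> 0"
    by (auto split: if_splits)
  then have "Poly_Mapping.lookup k i \<noteq> 0" by (metis mult_zero_left of_nat_0)
  then have "k = m + Poly_Mapping.single i 1"
    using k(2) by (intro poly_mapping_eqI) (auto simp: lookup_add lookup_minus lookup_single when_def)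
  then show ?thesis using k(1) that by blast
qed

lemma is_form_pd:
  assumes "is_form I (Suc d) g"
  shows "is_form I d (pd i g :: 'a::comm_ring_1 mpoly)"
  using assms poly_vars_pd[of i g] by (auto simp: is_form_iff mdeg_add elim!: keys_pdE)

lemma eval_form_smult:
  fixes v :: "'a::comm_ring_1 vec"
  assumes "is_form {..N} d g" "v \<in> carrier_vec (Suc N)"
  shows "eval g (c \<cdot>\<^sub>v v) = c ^ d * eval g v"
proof -
  have "Poly_Mapping.lookup g m * (\<Prod>i\<in>Poly_Mapping.keys m. ((c \<cdot>\<^sub>v v) $ i) ^ Poly_Mapping.lookup m i)
     = c ^ d * (Poly_Mapping.lookup g m * (\<Prod>i\<in>Poly_Mapping.keys m. (v $ i) ^ Poly_Mapping.lookup m i))"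
    if m: "m \<in> Poly_Mapping.keys g" for m
  proof -
    have "(\<Prod>i\<in>Poly_Mapping.keys m. ((c \<cdot>\<^sub>v v) $ i) ^ Poly_Mapping.lookup m i) =
        (\<Prod>i\<in>Poly_Mapping.keys m. (c * v $ i) ^ Poly_Mapping.lookup m i)"
      by (rule prod.cong) (use m assms in \<open>force simp: is_form_iff poly_vars_def\<close>)+
    also have "\<dots> = (\<Prod>i\<in>Poly_Mapping.keys m. c ^ Poly_Mapping.lookup m i) *
        (\<Prod>i\<in>Poly_Mapping.keys m. (v $ i) ^ Poly_Mapping.lookup m i)"
      by (simp add: power_mult_distrib prod.distrib)
    also have "(\<Prod>i\<in>Poly_Mapping.keys m. c ^ Poly_Mapping.lookup m i) = c ^ d"
      using m assms by (simp add: is_form_iff mdeg_def flip: power_sum)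
    finally show ?thesis by (simp add: mult_ac)
  qed
  then show ?thesis unfolding eval_def sum_distrib_left by (rule sum.cong[OF refl])
qed

lemma eval_cong:
  assumes "poly_vars g \<subseteq> I" "\<And>i. i \<in> I \<Longrightarrow> v $ i = w $ i"
  shows "eval g v = eval (g :: 'a::comm_ring_1 mpoly) w"
  unfolding eval_def using assms
  by (intro sum.cong prod.cong arg_cong2[where f = "(*)"] refl) (auto simp: poly_vars_def subset_iff)

lemma eval_psubst_Const:
  fixes v :: "'a::comm_ring_1 vec"
  assumes "poly_vars g \<subseteq> {..N}"
  shows "eval (psubst Const \<phi> g) v = eval g (vec (Suc N) (\<lambda>i. eval (\<phi> i) v))"
proof -
  interpret c: comm_ring_hom "Const :: 'a \<Rightarrow> 'a mpoly" by (rule comm_ring_hom_Const)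
  interpret ps: comm_ring_hom "psubst Const \<phi>" by (rule c.comm_ring_hom_psubst)
  show ?thesis using assms
    by (rule mpoly_ring_induct[where I = "{..N}"])
      (auto simp: c.psubst_Const c.psubst_Var eval.hom_add eval.hom_mult ps.hom_add ps.hom_mult)
qed

lemma poly_vars_psubst_Const:
  assumes "poly_vars g \<subseteq> I" "\<And>i. i \<in> I \<Longrightarrow> poly_vars (\<phi> i) \<subseteq> (J :: nat set)"
  shows "poly_vars (psubst Const \<phi> (g :: 'a::comm_ring_1 mpoly)) \<subseteq> J"
proof -
  interpret c: comm_ring_hom "Const :: 'a \<Rightarrow> 'a mpoly" by (rule comm_ring_hom_Const)
  interpret ps: comm_ring_hom "psubst Const \<phi>" by (rule c.comm_ring_hom_psubst)
  show ?thesis using assms(1)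
  proof (rule mpoly_ring_induct[where I = I])
    fix f g :: "'a mpoly" 
    assume "poly_vars (psubst Const \<phi> f) \<subseteq> J" "poly_vars (psubst Const \<phi> g) \<subseteq> J"
    then show "poly_vars (psubst Const \<phi> (f + g)) \<subseteq> J" "poly_vars (psubst Const \<phi> (f * g)) \<subseteq> J"
      using poly_vars_add poly_vars_mult unfolding ps.hom_add ps.hom_mult by blast+
  qed (use assms(2) in \<open>auto simp: c.psubst_Const c.psubst_Var\<close>)
qed

text \<open>In characteristic zero, differentiation with respect to a variable loses no monomial that contains
  this variable, and the derivatives of different such monomials do not cancel.\<close>

lemma notin_vars_if_pd_eq_0:
  fixes g :: "'a::{idom, ring_char_0} mpoly"
  assumes "pd i g = 0"
  shows "i \<notin> poly_vars g"
proof
  assume "i \<in> poly_vars g"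
  then obtain m where m: "m \<in> Poly_Mapping.keys g" and i: "Poly_Mapping.lookup m i \<noteq> 0"
    by (auto simp: poly_vars_def in_keys_iff)
  let ?e = "Poly_Mapping.single i (1::nat)"
  have inj: "k = m" if "k - ?e = m - ?e" "Poly_Mapping.lookup k i \<noteq> 0" for k
  proof (rule poly_mapping_eqI)
    fix j
    have "Poly_Mapping.lookup (k - ?e) j = Poly_Mapping.lookup (m - ?e) j" using that by simp
    then show "Poly_Mapping.lookup k j = Poly_Mapping.lookup m j"
      using that(2) i by (cases "i = j") (auto simp: lookup_minus lookup_single)
  qed
  have "Poly_Mapping.lookup (pd i g) (m - ?e) =
      (\<Sum>k\<in>Poly_Mapping.keys g. if k = m then of_nat (Poly_Mapping.lookup m i) * Poly_Mapping.lookup g m else 0)"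
    unfolding pd_def lookup_sum
    by (rule sum.cong[OF refl]) (use inj in \<open>auto simp: lookup_single when_def\<close>)
  also have "\<dots> = of_nat (Poly_Mapping.lookup m i) * Poly_Mapping.lookup g m"
    using m by simp
  finally show False using i m assms by (simp add: in_keys_iff)
qed

lemma const_if_all_pd_0:
  fixes g :: "'a::{idom, ring_char_0} mpoly"
  assumes "\<And>i. pd i g = 0"
  shows "\<exists>c. g = Const c"
proof -
  have "i \<notin> poly_vars g" for i
    using assms notin_vars_if_pd_eq_0 by blast
  then have key: "m = 0" if "m \<in> Poly_Mapping.keys g" for m
    using that by (intro poly_mapping_eqI) (auto simp: poly_vars_def in_keys_iff)
  have "g = Const (Poly_Mapping.lookup g 0)"
    by (rule poly_mapping_eqI) (use key in \<open>auto simp: Const_def lookup_single when_def in_keys_iff\<close>)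
  then show ?thesis by blast
qed

text \<open>A class of polynomials that is stable under partial derivatives and contains no nonzero constant
  contains no nonzero polynomial: the partial derivatives vanish by induction on the degree, so that
  the polynomial is constant. Both the injectivity of evaluation and the Jacobian criterion are
  instances.\<close>

lemma pd_stable_eq_0:
  fixes g :: "'a::{idom, ring_char_0} mpoly"
  assumes "P g" and pd: "\<And>i g. P g \<Longrightarrow> P (pd i g)" and const: "\<And>c. P (Const c) \<Longrightarrow> c = 0"
  shows "g = 0"
proof -
  have "g = 0" if "P g" "\<forall>m\<in>Poly_Mapping.keys g. mdeg m < n" for n and g :: "'a mpoly"
    using that
  proof (induction n arbitrary: g)
    case 0
    then show ?case by (auto simp: poly_mapping_eq_iff fun_eq_iff in_keys_iff)
  next
    case (Suc n)
    have "pd i g = 0" for i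
    proof (rule Suc.IH)
      show "P (pd i g)" by (rule pd[OF Suc.prems(1)])
      show "\<forall>m\<in>Poly_Mapping.keys (pd i g). mdeg m < n"
      proof
        fix m assume "m \<in> Poly_Mapping.keys (pd i g)"
        then obtain k where k: "k \<in> Poly_Mapping.keys g" "k = m + Poly_Mapping.single i 1"
          by (rule keys_pdE)
        then show "mdeg m < n" using Suc.prems(2) by (auto simp: mdeg_add)
      qed
    qed
    then obtain c where "g = Const c" using const_if_all_pd_0 by blast
    then show ?case using Suc.prems(1) const[of c] by simp
  qed
  moreover have "\<forall>m\<in>Poly_Mapping.keys g. mdeg m < Suc (Max (insert 0 (mdeg ` Poly_Mapping.keys g)))"
    by (auto simp: less_Suc_eq_le)
  ultimately show ?thesis using assms(1) by blast
qed

section \<open>Polynomials as functions\<close>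

lemma comm_ring_hom_pCons: "comm_ring_hom (\<lambda>c::'a::comm_ring_1. [:c:])"
  by unfold_locales (simp_all add: one_pCons)

lemma poly_psubst_line:
  fixes v w :: "'a::comm_ring_1 vec"
  assumes "poly_vars g \<subseteq> {..N}" "v \<in> carrier_vec (Suc N)" "w \<in> carrier_vec (Suc N)"
  shows "poly (psubst (\<lambda>c. [:c:]) (\<lambda>i. [:v $ i, w $ i:]) g) t = eval g (v + t \<cdot>\<^sub>v w)"
proof -
  interpret c: comm_ring_hom "\<lambda>c::'a. [:c:]" by (rule comm_ring_hom_pCons)
  interpret ps: comm_ring_hom "psubst (\<lambda>c::'a. [:c:]) (\<lambda>i. [:v $ i, w $ i:])"
    by (rule c.comm_ring_hom_psubst)
  show ?thesis using assms(1)
    by (rule mpoly_ring_induct[where I = "{..N}"])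
      (use assms(2,3) in \<open>auto simp: c.psubst_Const c.psubst_Var eval.hom_add eval.hom_mult ps.hom_add ps.hom_mult\<close>)
qed

text \<open>Two polynomial functions that do not vanish identically have a common point of nonvanishing:
  on the line that joins \<open>v\<close> and \<open>w\<close> both are nonzero polynomials in one variable, and so is their product.\<close>

lemma ex_common_nonzero:
  fixes v w :: "'a::field_char_0 vec"
  assumes "poly_vars g \<subseteq> {..N}" "v \<in> carrier_vec (Suc N)" "eval g v \<noteq> 0"
    and "poly_vars h \<subseteq> {..N}" "w \<in> carrier_vec (Suc N)" "eval h w \<noteq> 0"
  shows "\<exists>u\<in>carrier_vec (Suc N). eval g u \<noteq> 0 \<and> eval h u \<noteq> 0"
proof -
  let ?d = "w - v"
  define L where "L f = psubst (\<lambda>c::'a. [:c:]) (\<lambda>i. [:v $ i, ?d $ i:]) f" for f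
  have L: "poly (L f) t = eval f (v + t \<cdot>\<^sub>v ?d)" if "poly_vars f \<subseteq> {..N}" for f t
    unfolding L_def by (rule poly_psubst_line) (use that assms in auto)
  have "v + 0 \<cdot>\<^sub>v ?d = v" "v + 1 \<cdot>\<^sub>v ?d = w"
    using assms by (auto intro!: eq_vecI)
  then have "poly (L g) 0 \<noteq> 0" "poly (L h) 1 \<noteq> 0" using L assms by simp_all
  then have "L g * L h \<noteq> 0" by auto
  then obtain t where "poly (L g * L h) t \<noteq> 0"
    using poly_all_0_iff_0 by blast
  then show ?thesis
    using L assms by (intro bexI[of _ "v + t \<cdot>\<^sub>v ?d"]) auto
qed

lemma eq_0_if_eval_eq_0:
  fixes g :: "'a::field_char_0 mpoly"
  assumes "poly_vars g \<subseteq> {..N}" "\<And>v. v \<in> carrier_vec (Suc N) \<Longrightarrow> eval g v = 0"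
  shows "g = 0"
proof (rule pd_stable_eq_0[where P = "\<lambda>g. poly_vars g \<subseteq> {..N} \<and> (\<forall>v\<in>carrier_vec (Suc N). eval g v = 0)"])
  fix i and g :: "'a mpoly"
  assume g: "poly_vars g \<subseteq> {..N} \<and> (\<forall>v\<in>carrier_vec (Suc N). eval g v = 0)"
  have "eval (pd i g) v = 0" if v: "v \<in> carrier_vec (Suc N)" for v
  proof (cases "i \<le> N")
    case False
    then show ?thesis using g by (subst pd_eq_0_if_notin_vars[of i g]) auto
  next
    case True
    let ?w = "unit_vec (Suc N) i :: 'a vec"
    let ?\<phi> = "\<lambda>j. [:v $ j, ?w $ j:]"
    let ?L = "psubst (\<lambda>c::'a. [:c:]) ?\<phi>"
    have L: "poly (?L f) t = eval f (v + t \<cdot>\<^sub>v ?w)" if "poly_vars f \<subseteq> {..N}" for f t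
      by (rule poly_psubst_line) (use that v in auto)
    have "?L g = 0"
      using L[of g] g v by (subst poly_all_0_iff_0[symmetric]) auto
    then have "0 = pderiv (?L g)" by simp
    also have "\<dots> = (\<Sum>j\<le>N. ?L (pd j g) * pderiv (?\<phi> j))"
      by (rule chain_rule[OF comm_ring_hom_pCons])
        (use g in \<open>auto simp: pderiv_add pderiv_mult pderiv_pCons\<close>)
    also have "\<dots> = (\<Sum>j\<le>N. if j = i then ?L (pd i g) else 0)"
      by (rule sum.cong) (use True in \<open>auto simp: pderiv_pCons one_pCons[symmetric]\<close>)
    finally have "?L (pd i g) = 0" using True by simp
    then have "eval (pd i g) (v + 0 \<cdot>\<^sub>v ?w) = 0"
      using L[of "pd i g" 0] poly_vars_pd[of i g] g by auto
    moreover have "v + 0 \<cdot>\<^sub>v ?w = v" using v by (auto intro!: eq_vecI)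
    ultimately show ?thesis by simp
  qed
  then show "poly_vars (pd i g) \<subseteq> {..N} \<and> (\<forall>v\<in>carrier_vec (Suc N). eval (pd i g) v = 0)"
    using g poly_vars_pd[of i g] by auto
  show "c = 0" if "poly_vars (Const c) \<subseteq> {..N} \<and> (\<forall>v\<in>carrier_vec (Suc N). eval (Const c) v = 0)" for c :: 'a
    using that zero_carrier_vec[of "Suc N"] by (metis eval_Const)
qed (use assms in auto)

lemma is_form_vars: "is_form {..N} d g \<Longrightarrow> poly_vars g \<subseteq> {..N}"
  by (simp add: is_form_iff)

lemma proj_space_iff: "p \<in> proj_space N \<longleftrightarrow> p \<in> carrier_vec (Suc N) \<and> (\<exists>i\<le>N. p $ i \<noteq> 0)"
  by (auto simp: proj_space_def vec_eq_iff less_Suc_eq_le)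

lemma ex_common_nonzero_proj:
  fixes v w :: "'a::field_char_0 vec"
  assumes "poly_vars g \<subseteq> {..N}" "v \<in> carrier_vec (Suc N)" "eval g v \<noteq> 0"
    and "poly_vars h \<subseteq> {..N}" "w \<in> carrier_vec (Suc N)" "eval h w \<noteq> 0"
  shows "\<exists>u\<in>proj_space N. eval g u \<noteq> 0 \<and> eval h u \<noteq> 0"
proof -
  obtain u where u: "u \<in> carrier_vec (Suc N)" "eval (g * h) u \<noteq> 0"
    using ex_common_nonzero[OF assms] by (auto simp: eval.hom_mult)
  have "poly_vars (g * h) \<subseteq> {..N}" using poly_vars_mult[of g h] assms by auto
  then obtain x where "x \<in> carrier_vec (Suc N)" "eval (g * h) x \<noteq> 0" "eval (Var 0 :: 'a mpoly) x \<noteq> 0"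
    using ex_common_nonzero[of "g * h" N u "Var 0" "unit_vec (Suc N) 0"] u
    by (auto simp: poly_vars_Var)
  then show ?thesis by (intro bexI[of _ x]) (auto simp: eval.hom_mult proj_space_iff)
qed

text \<open>A polynomial that vanishes at the general point is zero.\<close>

lemma eval_generic_eq_0:
  fixes g s :: "'a::field_char_0 mpoly"
  assumes s: "poly_vars s \<subseteq> {..N}" "p \<in> carrier_vec (Suc N)" "eval s p \<noteq> 0"
    and g: "poly_vars g \<subseteq> {..N}" "\<And>q. q \<in> proj_space N \<Longrightarrow> eval s q \<noteq> 0 \<Longrightarrow> eval g q = 0"
  shows "g = 0"
proof (rule eq_0_if_eval_eq_0[OF g(1)], rule ccontr)
  fix v :: "'a vec" assume "v \<in> carrier_vec (Suc N)" "eval g v \<noteq> 0"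
  from ex_common_nonzero_proj[OF s g(1) this] g(2) show False by blast
qed

text \<open>General points can be described by the nonvanishing of a single form.\<close>

lemma for_general_iff:
  "for_general N P \<longleftrightarrow> (\<exists>s d. is_form {..N} d s \<and> (\<exists>p\<in>proj_space N. eval s p \<noteq> 0) \<and>
      (\<forall>p\<in>proj_space N. eval s p \<noteq> 0 \<longrightarrow> P p))"
proof
  assume "for_general N P"
  then obtain F where F: "\<forall>g\<in>F. \<exists>d. is_form {..N} d g" "zeros N F \<noteq> proj_space N"
    "\<forall>p\<in>proj_space N - zeros N F. P p"
    by (auto simp: for_general_def zariski_closed_def)
  then obtain p g where "p \<in> proj_space N" "g \<in> F" "eval g p \<noteq> 0" by (auto simp: zeros_def)
  moreover from this F obtain d where "is_form {..N} d g" by blast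
  ultimately show "\<exists>s d. is_form {..N} d s \<and> (\<exists>p\<in>proj_space N. eval s p \<noteq> 0) \<and>
      (\<forall>p\<in>proj_space N. eval s p \<noteq> 0 \<longrightarrow> P p)"
    using F(3) by (intro exI[of _ g] exI[of _ d]) (auto simp: zeros_def)
next
  assume "\<exists>s d. is_form {..N} d s \<and> (\<exists>p\<in>proj_space N. eval s p \<noteq> 0) \<and>
      (\<forall>p\<in>proj_space N. eval s p \<noteq> 0 \<longrightarrow> P p)"
  then obtain s d where s: "is_form {..N} d s" "\<exists>p\<in>proj_space N. eval s p \<noteq> 0"
      "\<forall>p\<in>proj_space N. eval s p \<noteq> 0 \<longrightarrow> P p" by blast
  have "zariski_closed N (zeros N {s})"
    unfolding zariski_closed_def using s by (intro exI[of _ "{s}"]) auto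
  then show "for_general N P"
    unfolding for_general_def using s by (intro exI[of _ "zeros N {s}"]) (auto simp: zeros_def)
qed

lemma for_general_mono:
  "for_general N P \<Longrightarrow> (\<And>p. p \<in> proj_space N \<Longrightarrow> P p \<Longrightarrow> Q p) \<Longrightarrow> for_general N Q"
  unfolding for_general_def by blast

lemma for_general_all:
  assumes "\<And>p. p \<in> proj_space N \<Longrightarrow> P (p :: 'a::comm_ring_1 vec)"
  shows "for_general N P"
  unfolding for_general_iff
proof (intro exI[of _ "Const 1"] exI[of _ 0] conjI)
  have "unit_vec (Suc N) 0 \<in> proj_space N" by (auto simp: proj_space_iff)
  then show "\<exists>p::'a vec\<in>proj_space N. eval (Const 1) p \<noteq> 0"
    by (intro bexI) (simp only: eval_Const one_neq_zero not_False_eq_True)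
qed (use assms is_form_Const[of _ "1::'a"] in auto)

section \<open>Homogeneous components\<close>

text \<open>The homogeneous component of degree \<open>d\<close>.\<close>

definition hom_comp :: "nat \<Rightarrow> 'a::comm_ring_1 mpoly \<Rightarrow> 'a mpoly" where
  "hom_comp d g = (\<Sum>m | m \<in> Poly_Mapping.keys g \<and> mdeg m = d. Poly_Mapping.single m (Poly_Mapping.lookup g m))"

lemma lookup_hom_comp: "Poly_Mapping.lookup (hom_comp d g) m = (if mdeg m = d then Poly_Mapping.lookup g m else 0)"
proof -
  have "Poly_Mapping.lookup (hom_comp d g) m =
      (\<Sum>x | x \<in> Poly_Mapping.keys g \<and> mdeg x = d. if x = m then Poly_Mapping.lookup g m else 0)"
    unfolding hom_comp_def lookup_sum by (rule sum.cong) (auto simp: lookup_single when_def)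
  then show ?thesis by (auto simp: in_keys_iff)
qed

lemma keys_hom_comp: "Poly_Mapping.keys (hom_comp d g) = {m \<in> Poly_Mapping.keys g. mdeg m = d}"
  by (auto simp: in_keys_iff lookup_hom_comp split: if_splits)

lemma is_form_hom_comp: "poly_vars g \<subseteq> I \<Longrightarrow> is_form I d (hom_comp d g)"
  by (auto simp: is_form_iff keys_hom_comp poly_vars_def)

text \<open>Along the line through the origin and \<open>v\<close>, a polynomial becomes a univariate polynomial whose
  coefficients are the values at \<open>v\<close> of the homogeneous components. This reduces statements on arbitrary
  polynomials on a cone to statements on forms.\<close>

lemma ex_scaling_poly:
  fixes v :: "'a::comm_ring_1 vec"
  assumes "poly_vars g \<subseteq> {..N}" "v \<in> carrier_vec (Suc N)"
  shows "\<exists>q. (\<forall>c. poly q c = eval g (c \<cdot>\<^sub>v v)) \<and> (\<forall>d. coeff q d = eval (hom_comp d g) v)"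
proof -
  define D where "D = Max (insert 0 (mdeg ` Poly_Mapping.keys g))"
  have D: "mdeg m \<le> D" if "m \<in> Poly_Mapping.keys g" for m
    using that by (auto simp: D_def)
  have 0: "hom_comp d g = 0" if "d > D" for d
    using D that by (intro poly_mapping_eqI) (force simp: lookup_hom_comp in_keys_iff)
  have g: "g = (\<Sum>d\<le>D. hom_comp d g)"
    using D by (intro poly_mapping_eqI) (auto simp: lookup_sum lookup_hom_comp in_keys_iff)
  define q where "q = (\<Sum>d\<le>D. monom (eval (hom_comp d g) v) d)"
  have "poly q c = eval g (c \<cdot>\<^sub>v v)" for c
  proof -
    have "eval g (c \<cdot>\<^sub>v v) = (\<Sum>d\<le>D. eval (hom_comp d g) (c \<cdot>\<^sub>v v))"
      by (subst g) (rule eval.hom_sum)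
    also have "\<dots> = (\<Sum>d\<le>D. c ^ d * eval (hom_comp d g) v)"
      using eval_form_smult[OF is_form_hom_comp[OF assms(1)] assms(2)] by simp
    finally show ?thesis by (simp add: q_def poly_sum poly_monom mult.commute)
  qed
  moreover have "coeff q d = eval (hom_comp d g) v" for d
    using 0[of d] by (cases "d \<le> D") (auto simp: q_def coeff_sum)
  ultimately show ?thesis by blast
qed

lemma poly_eq_0_if_nonzero_roots:
  assumes "\<And>c. c \<noteq> 0 \<Longrightarrow> poly q c = 0"
  shows "q = (0 :: 'a::field_char_0 poly)"
proof -
  have "poly ([:0,1:] * q) c = 0" for c using assms[of c] by (cases "c = 0") auto
  then have "[:0,1:] * q = 0" using poly_all_0_iff_0 by blast
  then show ?thesis by simp
qed

section \<open>Zariski topology\<close>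

lemma zeros_subset: "zeros N F \<subseteq> proj_space N"
  by (auto simp: zeros_def)

lemma proj_space_smult: "(v :: 'a::field vec) \<in> proj_space N \<Longrightarrow> c \<noteq> 0 \<Longrightarrow> c \<cdot>\<^sub>v v \<in> proj_space N"
  by (fastforce simp: proj_space_iff)

lemma zariski_closed_smult:
  assumes "zariski_closed N W" "v \<in> W" "c \<noteq> (0 :: 'a::field)"
  shows "c \<cdot>\<^sub>v v \<in> W"
proof -
  obtain F where F: "\<forall>g\<in>F. \<exists>d. is_form {..N} d g" "W = zeros N F"
    using assms(1) by (auto simp: zariski_closed_def)
  have "eval g (c \<cdot>\<^sub>v v) = 0" if g: "g \<in> F" for g
  proof -
    obtain d where "is_form {..N} d g" using F g by blast
    from eval_form_smult[OF this, of v c] show ?thesis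
      using assms F g by (auto simp: zeros_def proj_space_def)
  qed
  then show ?thesis using assms F proj_space_smult[of v N c] by (auto simp: zeros_def)
qed

lemma hom_comp_vanishes:
  fixes S :: "'a::field_char_0 vec set"
  assumes S: "S \<subseteq> proj_space N" "\<And>v c. v \<in> S \<Longrightarrow> c \<noteq> 0 \<Longrightarrow> c \<cdot>\<^sub>v v \<in> S"
    and g: "poly_vars g \<subseteq> {..N}" "\<And>v. v \<in> S \<Longrightarrow> eval g v = 0" and v: "v \<in> S"
  shows "eval (hom_comp d g) v = 0"
proof -
  have "v \<in> carrier_vec (Suc N)" using S v by (auto simp: proj_space_def)
  from ex_scaling_poly[OF g(1) this] obtain q where
    q: "\<And>c. poly q c = eval g (c \<cdot>\<^sub>v v)" "\<And>d. coeff q d = eval (hom_comp d g) v" by blast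
  have "q = 0" by (rule poly_eq_0_if_nonzero_roots) (use q g S v in auto)
  with q(2)[of d] show ?thesis by simp
qed

lemma eval_eq_0_if_hom_comp:
  fixes v :: "'a::comm_ring_1 vec"
  assumes "poly_vars g \<subseteq> {..N}" "v \<in> carrier_vec (Suc N)" "\<And>d. eval (hom_comp d g) v = 0"
  shows "eval g v = 0"
proof -
  from ex_scaling_poly[OF assms(1,2)] obtain q where
    q: "\<And>c. poly q c = eval g (c \<cdot>\<^sub>v v)" "\<And>d. coeff q d = eval (hom_comp d g) v" by blast
  then have "q = 0" using assms(3) by (intro poly_eqI) simp
  with q(1)[of 1] show ?thesis by simp
qed

lemma zariski_closed_zeros: "(\<And>g. g \<in> F \<Longrightarrow> \<exists>d. is_form {..N} d g) \<Longrightarrow> zariski_closed N (zeros N F)"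
  unfolding zariski_closed_def by (intro exI[of _ F]) simp

lemma zariski_closure_eq:
  assumes "S \<subseteq> proj_space N"
  shows "zariski_closure N S = zeros N {g. (\<exists>d. is_form {..N} d g) \<and> (\<forall>v\<in>S. eval g v = 0)}" (is "_ = ?Z")
proof
  have "zariski_closed N ?Z" by (rule zariski_closed_zeros) simp
  moreover have "S \<subseteq> ?Z" using assms by (auto simp: zeros_def)
  ultimately show "zariski_closure N S \<subseteq> ?Z" unfolding zariski_closure_def by (intro Inter_lower) simp
  show "?Z \<subseteq> zariski_closure N S"
    unfolding zariski_closure_def
  proof (intro Inter_greatest)
    fix T assume "T \<in> {T. zariski_closed N T \<and> S \<subseteq> T}"
    then obtain F where "\<forall>g\<in>F. \<exists>d. is_form {..N} d g" "T = zeros N F" "S \<subseteq> zeros N F"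
      by (auto simp: zariski_closed_def)
    then show "?Z \<subseteq> T" by (auto simp: zeros_def subset_iff)
  qed
qed

lemma zariski_closed_closure:
  "S \<subseteq> proj_space N \<Longrightarrow> zariski_closed N (zariski_closure N S)"
  by (subst zariski_closure_eq, assumption, rule zariski_closed_zeros) simp

lemma subset_zariski_closure: "S \<subseteq> zariski_closure N S"
  unfolding zariski_closure_def by blast

lemma zariski_closure_minimal: "zariski_closed N T \<Longrightarrow> S \<subseteq> T \<Longrightarrow> zariski_closure N S \<subseteq> T"
  unfolding zariski_closure_def by blast

text \<open>A closed set is defined by forms only, but arbitrary polynomials that vanish on a set stable under
  scaling vanish on its closure as well.\<close>

lemma eval_eq_0_on_closure:
  fixes S :: "'a::field_char_0 vec set"
  assumes S: "S \<subseteq> proj_space N" "\<And>v c. v \<in> S \<Longrightarrow> c \<noteq> 0 \<Longrightarrow> c \<cdot>\<^sub>v v \<in> S"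
    and g: "poly_vars g \<subseteq> {..N}" "\<And>v. v \<in> S \<Longrightarrow> eval g v = 0" and v: "v \<in> zariski_closure N S"
  shows "eval g v = 0"
proof (rule eval_eq_0_if_hom_comp[OF g(1)])
  have v': "v \<in> zeros N {g. (\<exists>d. is_form {..N} d g) \<and> (\<forall>v\<in>S. eval g v = 0)}"
    using v zariski_closure_eq[OF S(1)] by simp
  then show "v \<in> carrier_vec (Suc N)" by (auto simp: zeros_def proj_space_def)
  fix d
  have "\<forall>v\<in>S. eval (hom_comp d g) v = 0"
    using hom_comp_vanishes[OF S g] by blast
  then show "eval (hom_comp d g) v = 0"
    using v' is_form_hom_comp[OF g(1)] by (auto simp: zeros_def)
qed

lemma irreducible_closed_closure:
  fixes S :: "'a::field_char_0 vec set"
  assumes S: "S \<subseteq> proj_space N" "S \<noteq> {}"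
    and prime: "\<And>g h d e. is_form {..N} d g \<Longrightarrow> is_form {..N} e h \<Longrightarrow> \<forall>v\<in>S. eval g v * eval h v = 0 \<Longrightarrow>
      (\<forall>v\<in>S. eval g v = 0) \<or> (\<forall>v\<in>S. eval h v = 0)"
  shows "irreducible_closed N (zariski_closure N S)"
  unfolding irreducible_closed_def
proof (intro conjI allI impI)
  show "zariski_closed N (zariski_closure N S)" by (rule zariski_closed_closure[OF S(1)])
  show "zariski_closure N S \<noteq> {}" using S subset_zariski_closure[of S N] by blast
  fix A B assume AB: "zariski_closed N A \<and> zariski_closed N B \<and> zariski_closure N S = A \<union> B"
  have SAB: "S \<subseteq> A \<union> B" using AB subset_zariski_closure[of S N] by blast
  obtain F G where F: "\<forall>g\<in>F. \<exists>d. is_form {..N} d g" "A = zeros N F"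
    and G: "\<forall>g\<in>G. \<exists>d. is_form {..N} d g" "B = zeros N G"
    using AB by (auto simp: zariski_closed_def)
  have "S \<subseteq> A \<or> S \<subseteq> B"
  proof (rule ccontr)
    assume "\<not> ?thesis"
    then obtain v g w h where v: "v \<in> S" "g \<in> F" "eval g v \<noteq> 0" and w: "w \<in> S" "h \<in> G" "eval h w \<noteq> 0"
      using F G S by (auto simp: zeros_def subset_iff)
    obtain d e where "is_form {..N} d g" "is_form {..N} e h" using F G v w by blast
    moreover have "\<forall>v\<in>S. eval g v * eval h v = 0"
      using SAB F(2) G(2) v(2) w(2) by (auto simp: zeros_def subset_iff)
    ultimately show False using prime v w by blast
  qed
  then show "A = zariski_closure N S \<or> B = zariski_closure N S"
    using zariski_closure_minimal[of N A S] zariski_closure_minimal[of N B S] AB by auto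
qed

lemma irreducible_closed_proj_space: "irreducible_closed N (proj_space N :: 'a::field_char_0 vec set)"
proof -
  have "zariski_closed N (proj_space N :: 'a vec set)"
    unfolding zariski_closed_def by (intro exI[of _ "{}"]) (auto simp: zeros_def)
  then have eq: "zariski_closure N (proj_space N :: 'a vec set) = proj_space N"
    using zariski_closure_minimal[of N "proj_space N" "proj_space N"] subset_zariski_closure[of "proj_space N" N] by blast
  have "irreducible_closed N (zariski_closure N (proj_space N :: 'a vec set))"
  proof (rule irreducible_closed_closure)
    have "unit_vec (Suc N) 0 \<in> (proj_space N :: 'a vec set)" by (auto simp: proj_space_iff)
    then show "proj_space N \<noteq> ({} :: 'a vec set)" by blast
    fix g h :: "'a mpoly" and d e
    assume gh: "is_form {..N} d g" "is_form {..N} e h" "\<forall>v\<in>proj_space N. eval g v * eval h v = 0"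
    show "(\<forall>v\<in>proj_space N. eval g v = 0) \<or> (\<forall>v\<in>proj_space N. eval h v = 0)"
    proof (rule ccontr)
      assume "\<not> ?thesis"
      then obtain v w where "v \<in> proj_space N" "w \<in> proj_space N" "eval g v \<noteq> 0" "eval h w \<noteq> 0" by blast
      with ex_common_nonzero_proj[of g N v h w] gh show False
        by (auto simp: is_form_iff proj_space_def)
    qed
  qed simp
  then show ?thesis by (simp add: eq)
qed

text \<open>The ideal of all polynomials, homogeneous or not, that vanish on an irreducible closed set is prime.
  For a product \<open>a * b\<close> that vanishes on \<open>W\<close>, every line through the origin in \<open>W\<close> is contained in the closed set
  of the common zeros of the components of \<open>a\<close> or in the one that belongs to \<open>b\<close>.\<close>

lemma irreducible_closed_prime:
  fixes W :: "'a::field_char_0 vec set"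
  assumes W: "irreducible_closed N W"
    and a: "poly_vars a \<subseteq> {..N}" and b: "poly_vars b \<subseteq> {..N}"
    and ab: "\<And>v. v \<in> W \<Longrightarrow> eval a v * eval b v = 0"
  shows "(\<forall>v\<in>W. eval a v = 0) \<or> (\<forall>v\<in>W. eval b v = 0)"
proof -
  obtain F where F: "\<forall>g\<in>F. \<exists>d. is_form {..N} d g" "W = zeros N F"
    using W by (auto simp: irreducible_closed_def zariski_closed_def)
  define V where "V g = {v \<in> W. \<forall>d. eval (hom_comp d g) v = 0}" for g
  have Vclosed: "zariski_closed N (V g)" if "poly_vars g \<subseteq> {..N}" for g
    unfolding zariski_closed_def
  proof (intro exI[of _ "F \<union> range (\<lambda>d. hom_comp d g)"] conjI)
    show "\<forall>h\<in>F \<union> range (\<lambda>d. hom_comp d g). \<exists>d. is_form {..N} d h"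
      using F is_form_hom_comp[OF that] by blast
  qed (auto simp: V_def F(2) zeros_def)
  have V0: "eval g v = 0" if "poly_vars g \<subseteq> {..N}" "v \<in> V g" for g v
    by (rule eval_eq_0_if_hom_comp[OF that(1)]) (use that in \<open>auto simp: V_def F(2) zeros_def proj_space_def\<close>)
  have "v \<in> V a \<union> V b" if v: "v \<in> W" for v
  proof -
    have vc: "v \<in> carrier_vec (Suc N)" using v by (auto simp: F(2) zeros_def proj_space_def)
    obtain p q where p: "\<And>c. poly p c = eval a (c \<cdot>\<^sub>v v)" "\<And>d. coeff p d = eval (hom_comp d a) v"
      and q: "\<And>c. poly q c = eval b (c \<cdot>\<^sub>v v)" "\<And>d. coeff q d = eval (hom_comp d b) v"
      using ex_scaling_poly[OF a vc] ex_scaling_poly[OF b vc] by blast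
    have "p * q = 0"
    proof (rule poly_eq_0_if_nonzero_roots)
      fix c :: 'a assume "c \<noteq> 0"
      then have "c \<cdot>\<^sub>v v \<in> W" using zariski_closed_smult v W by (auto simp: irreducible_closed_def)
      then show "poly (p * q) c = 0" using ab p q by simp
    qed
    then have "p = 0 \<or> q = 0" by simp
    then show ?thesis using p(2) q(2) v by (auto simp: V_def)
  qed
  then have "W = V a \<union> V b" by (auto simp: V_def)
  then have "V a = W \<or> V b = W"
    using W Vclosed a b unfolding irreducible_closed_def by metis
  then show ?thesis using V0 a b by metis
qed

section \<open>Two nested prime ideals of a polynomial ring\<close>

text \<open>The univariate polynomials with coefficients in the set \<open>R\<close>. Subrings are represented by sets of elements
  of the ambient ring.\<close>

definition coeffs_in :: "'r::zero set \<Rightarrow> 'r poly \<Rightarrow> bool" where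
  "coeffs_in R P \<longleftrightarrow> (\<forall>i. coeff P i \<in> R)"

text \<open>The set \<open>R\<close> is a subring with unit.\<close>

definition subring_set :: "'r::comm_ring_1 set \<Rightarrow> bool" where
  "subring_set R \<longleftrightarrow> 0 \<in> R \<and> 1 \<in> R \<and> (\<forall>a\<in>R. \<forall>b\<in>R. a + b \<in> R \<and> a * b \<in> R \<and> a - b \<in> R)"

lemma subring_set_sum: "subring_set R \<Longrightarrow> (\<And>x. x \<in> A \<Longrightarrow> f x \<in> R) \<Longrightarrow> sum f A \<in> R"
  by (induction A rule: infinite_finite_induct) (auto simp: subring_set_def)

lemma subring_set_power: "subring_set R \<Longrightarrow> a \<in> R \<Longrightarrow> a ^ n \<in> R"
  by (induction n) (auto simp: subring_set_def)

lemma coeffs_in_add: "subring_set R \<Longrightarrow> coeffs_in R P \<Longrightarrow> coeffs_in R Q \<Longrightarrow> coeffs_in R (P + Q)"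
  by (auto simp: coeffs_in_def subring_set_def)

lemma coeffs_in_diff: "subring_set R \<Longrightarrow> coeffs_in R P \<Longrightarrow> coeffs_in R Q \<Longrightarrow> coeffs_in R (P - Q)"
  by (auto simp: coeffs_in_def subring_set_def)

lemma coeffs_in_mult: "subring_set R \<Longrightarrow> coeffs_in R P \<Longrightarrow> coeffs_in R Q \<Longrightarrow> coeffs_in R (P * Q)"
  by (auto simp: coeffs_in_def coeff_mult intro!: subring_set_sum) (auto simp: subring_set_def)

lemma coeffs_in_smult: "subring_set R \<Longrightarrow> a \<in> R \<Longrightarrow> coeffs_in R P \<Longrightarrow> coeffs_in R (Polynomial.smult a P)"
  by (auto simp: coeffs_in_def subring_set_def)

lemma coeffs_in_monom: "subring_set R \<Longrightarrow> a \<in> R \<Longrightarrow> coeffs_in R (monom a n)"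
  by (auto simp: coeffs_in_def subring_set_def)

lemma coeffs_in_pCons: "coeffs_in R (pCons a P) \<longleftrightarrow> a \<in> R \<and> coeffs_in R P"
  unfolding coeffs_in_def by (auto simp: coeff_pCons split: nat.splits)

lemma lead_coeff_in: "coeffs_in R P \<Longrightarrow> lead_coeff P \<in> R"
  by (simp add: coeffs_in_def)

lemma coeffs_in_0: "subring_set R \<Longrightarrow> coeffs_in R 0"
  by (auto simp: coeffs_in_def subring_set_def)

text \<open>Pseudo-division, with control of the coefficients.\<close>

lemma ex_pseudo_division:
  fixes G :: "'r::idom poly"
  assumes R: "subring_set R" and G: "coeffs_in R G" "G \<noteq> 0" and P: "coeffs_in R P"
  shows "\<exists>s Q S. coeffs_in R Q \<and> coeffs_in R S \<and> Polynomial.smult (lead_coeff G ^ s) P = Q * G + S \<and>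
    (S = 0 \<or> degree S < degree G)"
proof -
  have lc: "lead_coeff G \<in> R" using G by (simp add: coeffs_in_def)
  have "\<exists>s Q S. coeffs_in R Q \<and> coeffs_in R S \<and> Polynomial.smult (lead_coeff G ^ s) P = Q * G + S \<and>
    (S = 0 \<or> degree S < degree G)" if "coeffs_in R P" "P = 0 \<or> degree P < n" for n P
    using that
  proof (induction n arbitrary: P)
    case 0
    then show ?case by (intro exI[of _ 0] exI[of _ "0 :: 'r poly"]) (auto simp: coeffs_in_0[OF R])
  next
    case (Suc n)
    show ?case
    proof (cases "P = 0 \<or> degree P < degree G")
      case True
      then show ?thesis using Suc.prems
        by (intro exI[of _ 0] exI[of _ "0 :: 'r poly"] exI[of _ P]) (auto simp: coeffs_in_0[OF R])
    next
      case False
      let ?M = "monom (lead_coeff P) (degree P - degree G)"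
      let ?P = "Polynomial.smult (lead_coeff G) P - ?M * G"
      have M: "coeffs_in R ?M"
        by (rule coeffs_in_monom[OF R]) (use Suc.prems in \<open>simp add: coeffs_in_def\<close>)
      have P': "coeffs_in R ?P"
        by (intro coeffs_in_diff coeffs_in_smult coeffs_in_mult R lc M G Suc.prems)
      \<comment> \<open>The leading terms cancel. If \<open>P\<close> has degree 0, then \<open>?P\<close> is zero.\<close>
      have "degree ?P \<le> degree P"
        using False degree_mult_le[of ?M G] degree_monom_le[of "lead_coeff P" "degree P - degree G"]
        by (intro degree_diff_le) (auto intro: order.trans[OF degree_smult_le])
      moreover have "coeff ?P (degree P) = 0"
        using False by (simp add: coeff_monom_mult)
      ultimately have "?P = 0 \<or> degree ?P < degree P" by (rule eq_zero_or_degree_less)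
      then have "?P = 0 \<or> degree ?P < n" using Suc.prems(2) by auto
      from Suc.IH[OF P' this] obtain s Q S where IH: "coeffs_in R Q" "coeffs_in R S"
        "Polynomial.smult (lead_coeff G ^ s) ?P = Q * G + S" "S = 0 \<or> degree S < degree G" by blast
      have "Polynomial.smult (lead_coeff G ^ Suc s) P = (Q + Polynomial.smult (lead_coeff G ^ s) ?M) * G + S"
        using IH(3) by (simp add: algebra_simps smult_diff_right)
      moreover have "coeffs_in R (Q + Polynomial.smult (lead_coeff G ^ s) ?M)"
        by (intro coeffs_in_add coeffs_in_smult subring_set_power R IH M lc)
      ultimately show ?thesis using IH by blast
    qed
  qed
  from this[OF P, of "Suc (degree P)"] show ?thesis by simp
qed

text \<open>Let \<open>J\<close> be an ideal of the polynomials in one variable over the domain \<open>R\<close> that contains no nonzero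
  constant. Then a nonzero prime ideal \<open>I\<close> contained in \<open>J\<close> is equal to \<open>J\<close>. Otherwise choose \<open>G\<close> in \<open>I - {0}\<close> and
  \<open>h\<close> in \<open>J - I\<close>, both of minimal degree. The pseudo-remainder of \<open>h\<close> modulo \<open>G\<close> is again in \<open>J - I\<close>, so \<open>h\<close> has
  smaller degree than \<open>G\<close>. The pseudo-remainder of \<open>G\<close> modulo \<open>h\<close> is in \<open>J\<close> and of smaller degree than \<open>h\<close>,
  hence it is in \<open>I\<close>, hence it is zero. The quotient then is an element of \<open>I - {0}\<close> of smaller degree
  than \<open>G\<close>.\<close>

lemma no_intermediate_prime:
  fixes I J :: "'r::idom poly set"
  assumes R: "subring_set R"
    and IJ: "I \<subseteq> J" "\<And>P. P \<in> J \<Longrightarrow> coeffs_in R P"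
    and I0: "0 \<in> I" and I_mult: "\<And>P Q. P \<in> I \<Longrightarrow> coeffs_in R Q \<Longrightarrow> Q * P \<in> I"
    and I_add: "\<And>P Q. P \<in> I \<Longrightarrow> Q \<in> I \<Longrightarrow> P + Q \<in> I"
    and J_mult: "\<And>P Q. P \<in> J \<Longrightarrow> coeffs_in R Q \<Longrightarrow> Q * P \<in> J"
    and J_diff: "\<And>P Q. P \<in> J \<Longrightarrow> Q \<in> J \<Longrightarrow> P - Q \<in> J"
    and prime: "\<And>P Q. coeffs_in R P \<Longrightarrow> coeffs_in R Q \<Longrightarrow> P * Q \<in> I \<Longrightarrow> P \<in> I \<or> Q \<in> I"
    and const: "\<And>c. [:c:] \<in> J \<Longrightarrow> c = 0"
    and nontriv: "G0 \<in> I" "G0 \<noteq> 0"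
  shows "J \<subseteq> I"
proof (rule ccontr)
  assume "\<not> J \<subseteq> I"
  then obtain h0 where h0: "h0 \<in> J - I" by blast
  obtain G where G: "G \<in> I" "G \<noteq> 0" and G_min: "\<And>P. P \<in> I \<Longrightarrow> P \<noteq> 0 \<Longrightarrow> degree G \<le> degree P"
    using arg_min_natI[of "\<lambda>P. P \<in> I \<and> P \<noteq> 0" G0 degree] arg_min_nat_le[of "\<lambda>P. P \<in> I \<and> P \<noteq> 0" _ degree] nontriv
    by blast
  obtain h where h: "h \<in> J - I" and h_min: "\<And>P. P \<in> J - I \<Longrightarrow> degree h \<le> degree P"
    using arg_min_natI[of "\<lambda>P. P \<in> J - I" h0 degree] arg_min_nat_le[of "\<lambda>P. P \<in> J - I" _ degree] h0
    by blast
  have cG: "coeffs_in R G" and ch: "coeffs_in R h" using G h IJ by auto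
  have h0: "h \<noteq> 0" using h I0 by auto
  have deg_pos: "degree P > 0" if "P \<in> J" "P \<noteq> 0" for P
    using that const by (metis degree_eq_zeroE gr0I pCons_eq_0_iff)
  have not_const: "[:c:] \<notin> I" if "c \<noteq> 0" for c
    using that const IJ by blast
  have "degree h < degree G"
  proof -
    obtain s Q S where S: "coeffs_in R Q" "coeffs_in R S" "Polynomial.smult (lead_coeff G ^ s) h = Q * G + S"
      "S = 0 \<or> degree S < degree G"
      using ex_pseudo_division[OF R cG G(2) ch] by blast
    let ?c = "[:lead_coeff G ^ s:]"
    have c: "coeffs_in R ?c"
      using lead_coeff_in[OF cG] by (simp add: coeffs_in_pCons coeffs_in_0 R subring_set_power)
    have ch': "?c * h \<notin> I"
      using prime[OF c ch] not_const[of "lead_coeff G ^ s"] G h by auto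
    have "Q * G \<in> I" using I_mult G S by blast
    moreover have "S = ?c * h - Q * G" using S(3) by (simp add: algebra_simps)
    moreover have "?c * h \<in> J" using J_mult c h by blast
    ultimately have "S \<in> J" using J_diff IJ by blast
    moreover have "S \<notin> I"
    proof
      assume "S \<in> I"
      then have "Q * G + S \<in> I" using I_add \<open>Q * G \<in> I\<close> by blast
      with ch' S(3) show False by simp
    qed
    ultimately have "degree h \<le> degree S" "S \<noteq> 0" using h_min I0 by auto
    then show ?thesis using S(4) by auto
  qed
  obtain s Q S where S: "coeffs_in R Q" "coeffs_in R S" "Polynomial.smult (lead_coeff h ^ s) G = Q * h + S"
      "S = 0 \<or> degree S < degree h"
    using ex_pseudo_division[OF R ch h0 cG] by blast
  let ?c = "[:lead_coeff h ^ s:]"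
  have c: "coeffs_in R ?c"
    using lead_coeff_in[OF ch] by (simp add: coeffs_in_pCons coeffs_in_0 R subring_set_power)
  have cG': "?c * G \<in> I" using I_mult c G by blast
  have "S = ?c * G - Q * h" using S(3) by (simp add: algebra_simps)
  moreover have "Q * h \<in> J" using J_mult h S by blast
  ultimately have "S \<in> J" using J_diff cG' IJ by blast
  have "S = 0"
  proof (rule ccontr)
    assume "S \<noteq> 0"
    then have "degree S < degree h" using S by blast
    then have "S \<in> I" using h_min \<open>S \<in> J\<close> by force
    with G_min[OF this \<open>S \<noteq> 0\<close>] \<open>degree S < degree h\<close> \<open>degree h < degree G\<close> show False by simp
  qed
  then have eq: "?c * G = Q * h" using S by simp
  then have "Q \<in> I" using prime[OF S(1) ch] cG' h by auto
  moreover have "Q \<noteq> 0" using eq G h0 by auto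
  ultimately have "degree G \<le> degree Q" using G_min by blast
  moreover have "degree G = degree Q + degree h"
    using arg_cong[OF eq, of degree] \<open>Q \<noteq> 0\<close> h0 by (simp add: degree_mult_eq)
  moreover have "degree h > 0" using deg_pos h h0 by blast
  ultimately show False by simp
qed

lemma subring_set_vars: "subring_set {c :: 'a::comm_ring_1 mpoly. poly_vars c \<subseteq> I}"
  unfolding subring_set_def
  by (auto dest!: subsetD[OF poly_vars_add] subsetD[OF poly_vars_mult] subsetD[OF poly_vars_diff])

text \<open>A polynomial in the variables \<open>x_0, ..., x_N\<close> is a polynomial in the single variable \<open>x_k\<close> whose
  coefficients do not contain \<open>x_k\<close>.\<close>

lemma ex_poly_Var_representation:
  assumes "poly_vars g \<subseteq> {..N}"
  shows "\<exists>P. coeffs_in {c. poly_vars c \<subseteq> {..N} - {k}} P \<and> poly P (Var k) = (g :: 'a::comm_ring_1 mpoly)"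
    (is "\<exists>P. coeffs_in ?R P \<and> _")
  using assms
proof (rule mpoly_ring_induct[where I = "{..N}"])
  note R = subring_set_vars[of "{..N} - {k}", where 'a = 'a]
  fix c :: 'a
  show "\<exists>P. coeffs_in ?R P \<and> poly P (Var k) = Const c"
    by (rule exI[of _ "[:Const c:]"]) (auto simp: coeffs_in_pCons coeffs_in_0[OF R])
next
  note R = subring_set_vars[of "{..N} - {k}", where 'a = 'a]
  fix i assume "i \<in> {..N}"
  then show "\<exists>P. coeffs_in ?R P \<and> poly P (Var k) = Var i"
    by (intro exI[of _ "if i = k then [:0, 1:] else [:Var i:]"])
      (auto simp: coeffs_in_pCons coeffs_in_0[OF R] poly_vars_Var)
next
  note R = subring_set_vars[of "{..N} - {k}", where 'a = 'a]
  fix f g :: "'a mpoly"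
  assume "\<exists>P. coeffs_in ?R P \<and> poly P (Var k) = f" "\<exists>P. coeffs_in ?R P \<and> poly P (Var k) = g"
  then obtain P Q where "coeffs_in ?R P" "poly P (Var k) = f" "coeffs_in ?R Q" "poly Q (Var k) = g" by blast
  then show "\<exists>P. coeffs_in ?R P \<and> poly P (Var k) = f + g" "\<exists>P. coeffs_in ?R P \<and> poly P (Var k) = f * g"
    using coeffs_in_add[OF R, of P Q] coeffs_in_mult[OF R, of P Q]
    by (auto intro: exI[of _ "P + Q"] exI[of _ "P * Q"])
qed

lemma poly_vars_poly_Var:
  assumes "coeffs_in {c. poly_vars c \<subseteq> {..N} - {k}} P" "k \<le> N"
  shows "poly_vars (poly P (Var k :: 'a::comm_ring_1 mpoly)) \<subseteq> {..N}"
proof -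
  note R = subring_set_vars[of "{..N}", where 'a = 'a]
  have *: "(Var k :: 'a mpoly) ^ i \<in> {c. poly_vars c \<subseteq> {..N}}" for i
    by (rule subring_set_power[OF R]) (use assms in \<open>simp add: poly_vars_Var\<close>)
  have "poly P (Var k) \<in> {c. poly_vars c \<subseteq> {..N}}"
    unfolding poly_altdef
  proof (rule subring_set_sum[OF R])
    fix i
    have "coeff P i \<in> {c. poly_vars c \<subseteq> {..N}}" using assms(1) by (auto simp: coeffs_in_def)
    then show "coeff P i * Var k ^ i \<in> {c. poly_vars c \<subseteq> {..N}}"
      using R * by (auto simp: subring_set_def)
  qed
  then show ?thesis by simp
qed

section \<open>Closed sets of codimension one\<close>

text \<open>If the coordinates with index different from \<open>k\<close> are algebraically independent on \<open>Z\<close>, then no irreducible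
  closed set lies strictly between \<open>Z\<close> and the projective space.\<close>

lemma no_intermediate_closed:
  fixes Z W :: "'a::field_char_0 vec set"
  assumes k: "k \<le> N" and Z: "zariski_closed N Z" and W: "irreducible_closed N W"
    and ZW: "Z \<subseteq> W" "W \<noteq> proj_space N"
    and indep: "\<And>c. poly_vars c \<subseteq> {..N} - {k} \<Longrightarrow> (\<And>v. v \<in> Z \<Longrightarrow> eval c v = 0) \<Longrightarrow> c = 0"
  shows "W = Z"
proof -
  let ?R = "{c :: 'a mpoly. poly_vars c \<subseteq> {..N} - {k}}"
  define I where "I T = {P. coeffs_in ?R P \<and> (\<forall>v\<in>T. eval (poly P (Var k)) v = 0)}" for T
  note R = subring_set_vars[of "{..N} - {k}", where 'a = 'a]
  obtain F where F: "\<forall>g\<in>F. \<exists>d. is_form {..N} d g" "W = zeros N F"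
    using W by (auto simp: irreducible_closed_def zariski_closed_def)
  obtain G where G: "\<forall>g\<in>G. \<exists>d. is_form {..N} d g" "Z = zeros N G"
    using Z by (auto simp: zariski_closed_def)
  obtain p g where p: "p \<in> proj_space N" "g \<in> F" "eval g p \<noteq> 0"
    using ZW(2) zeros_subset[of N F] F(2) by (auto simp: zeros_def)
  then obtain P where P: "coeffs_in ?R P" "poly P (Var k) = g"
    using ex_poly_Var_representation[of g N k] F(1) is_form_vars by blast
  have "I Z \<subseteq> I W"
  proof (rule no_intermediate_prime[OF R, where ?G0.0 = P])
    fix A B assume AB: "coeffs_in ?R A" "coeffs_in ?R B" "A * B \<in> I W"
    show "A \<in> I W \<or> B \<in> I W"
      using irreducible_closed_prime[OF W poly_vars_poly_Var[OF AB(1) k] poly_vars_poly_Var[OF AB(2) k]] AB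
      by (auto simp: I_def eval.hom_mult)
  next
    fix c assume "[:c:] \<in> I Z"
    then show "c = 0" using indep[of c] by (auto simp: I_def coeffs_in_pCons)
  next
    show "P \<in> I W" using P p F by (auto simp: I_def zeros_def)
    show "P \<noteq> 0" using P p by auto
  qed (use ZW R in \<open>auto simp: I_def eval.hom_mult eval.hom_add eval.hom_minus coeffs_in_0 coeffs_in_add coeffs_in_diff coeffs_in_mult\<close>)
  have "W \<subseteq> Z"
  proof
    fix v assume v: "v \<in> W"
    have "eval g v = 0" if g: "g \<in> G" for g
    proof -
      obtain P where P: "coeffs_in ?R P" "poly P (Var k) = g"
        using ex_poly_Var_representation[of g N k] G(1) is_form_vars g by blast
      then have "P \<in> I Z" using g G by (auto simp: I_def zeros_def)
      with \<open>I Z \<subseteq> I W\<close> v P show ?thesis by (auto simp: I_def)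
    qed
    then show "v \<in> Z" using v zeros_subset[of N F] F G by (auto simp: zeros_def)
  qed
  with ZW show ?thesis by blast
qed

lemma codim_eq_1:
  fixes Z :: "'a::field_char_0 vec set"
  assumes "irreducible_closed N Z" "Z \<noteq> proj_space N"
    and max: "\<And>W. irreducible_closed N W \<Longrightarrow> Z \<subseteq> W \<Longrightarrow> W \<noteq> proj_space N \<Longrightarrow> W = Z"
  shows "codim N Z = 1"
proof -
  have sub: "W \<subseteq> proj_space N" if "irreducible_closed N W" for W
    using that zeros_subset by (auto simp: irreducible_closed_def zariski_closed_def)
  let ?C = "{n. \<exists>W :: nat \<Rightarrow> 'a vec set. W 0 = Z \<and>
       (\<forall>i\<le>n. irreducible_closed N (W i)) \<and> (\<forall>i<n. W i \<subset> W (Suc i))}"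
  have "n \<le> 1" if "n \<in> ?C" for n
  proof (rule ccontr)
    assume n: "\<not> n \<le> 1"
    from that obtain W where W: "W 0 = Z" "\<forall>i\<le>n. irreducible_closed N (W i)" "\<forall>i<n. W i \<subset> W (Suc i)" by blast
    have "W 0 \<subset> W 1" "W 1 \<subset> W 2" "irreducible_closed N (W 1)" "irreducible_closed N (W 2)"
      using W n by (auto simp: numeral_2_eq_2)
    moreover from this have "W 1 \<noteq> proj_space N" using sub by blast
    ultimately show False using max[of "W 1"] W(1) by auto
  qed
  then have "codim N Z \<le> 1"
    unfolding codim_def by (intro SUP_least) (auto simp: one_enat_def)
  moreover have "1 \<in> ?C"
    using assms sub[OF assms(1)] irreducible_closed_proj_space
    by (auto intro!: exI[of _ "\<lambda>i. if i = 0 then Z else proj_space N"])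
  then have "enat 1 \<le> codim N Z" unfolding codim_def by (rule SUP_upper)
  ultimately show ?thesis by (simp add: one_enat_def)
qed

section \<open>The Jacobian criterion and the polar image\<close>

interpretation Const: comm_ring_hom "Const :: 'a::comm_ring_1 \<Rightarrow> 'a mpoly"
  by (rule comm_ring_hom_Const)

interpretation psubst_Const: comm_ring_hom "psubst Const \<phi> :: 'a::comm_ring_1 mpoly \<Rightarrow> 'a mpoly" for \<phi>
  by (rule Const.comm_ring_hom_psubst)

lemma gradient_carrier [simp]: "gradient N f p \<in> carrier_vec (Suc N)"
  by (simp add: gradient_def)

lemma eval_psubst_gradient:
  "poly_vars g \<subseteq> {..N} \<Longrightarrow> eval (psubst Const (\<lambda>i. pd i f) g) p = eval g (gradient N f (p :: 'a::comm_ring_1 vec))"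
  by (simp add: eval_psubst_Const gradient_def)

text \<open>If the rows with index different from \<open>k\<close> of the Hessian matrix are linearly independent at the general
  point, then the partial derivatives \<open>\<partial>\<^sub>i f\<close> with \<open>i \<noteq> k\<close> are algebraically independent. Differentiating a
  relation \<open>g(\<partial>\<^sub>0 f, ..., \<partial>\<^sub>N f) = 0\<close> gives a linear relation between these rows, so that the partial
  derivatives of \<open>g\<close> are relations as well.\<close>

lemma jacobian_criterion:
  fixes f :: "'a::field_char_0 mpoly"
  assumes f: "poly_vars f \<subseteq> {..N}"
    and s: "poly_vars s \<subseteq> {..N}" "p0 \<in> carrier_vec (Suc N)" "eval s p0 \<noteq> 0"
    and rank: "\<And>p u. p \<in> proj_space N \<Longrightarrow> eval s p \<noteq> 0 \<Longrightarrow>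
      (\<And>j. j \<le> N \<Longrightarrow> (\<Sum>i\<le>N. u i * eval (pd j (pd i f)) p) = 0) \<Longrightarrow> u k = 0 \<Longrightarrow> (\<forall>i\<le>N. u i = 0)"
    and g: "poly_vars g \<subseteq> {..N} - {k}" "psubst Const (\<lambda>i. pd i f) g = 0"
  shows "g = 0"
proof (rule pd_stable_eq_0[where P = "\<lambda>g. poly_vars g \<subseteq> {..N} - {k} \<and> psubst Const (\<lambda>i. pd i f) g = 0"])
  let ?\<psi> = "psubst Const (\<lambda>i. pd i f)"
  fix l and g :: "'a mpoly"
  assume g: "poly_vars g \<subseteq> {..N} - {k} \<and> ?\<psi> g = 0"
  have gN: "poly_vars g \<subseteq> {..N}" using g by auto
  have pdk: "pd k g = 0" by (rule pd_eq_0_if_notin_vars) (use g in auto)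
  have "(\<Sum>i\<le>N. ?\<psi> (pd i g) * pd j (pd i f)) = 0" for j
    using chain_rule[OF comm_ring_hom_Const, where \<delta> = "pd j" and g = g and N = N and \<phi> = "\<lambda>i. pd i f"] g
    by (auto simp: pd_add pd_mult)
  then have rel: "(\<Sum>i\<le>N. eval (?\<psi> (pd i g)) p * eval (pd j (pd i f)) p) = 0" for j p
    by (metis (no_types, lifting) eval.hom_sum eval.hom_mult eval.hom_zero sum.cong)
  have "?\<psi> (pd l g) = 0"
  proof (cases "l \<le> N")
    case False
    then have "pd l g = 0" by (intro pd_eq_0_if_notin_vars) (use gN in auto)
    then show ?thesis by simp
  next
    case True
    show ?thesis
    proof (rule eval_generic_eq_0[OF s])
      have "poly_vars (pd i f) \<subseteq> {..N}" for i using f poly_vars_pd[of i f] by blast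
      moreover have "poly_vars (pd l g) \<subseteq> {..N}" using gN poly_vars_pd[of l g] by blast
      ultimately show "poly_vars (?\<psi> (pd l g)) \<subseteq> {..N}" by (rule poly_vars_psubst_Const[rotated])
      fix q assume q: "q \<in> proj_space N" "eval s q \<noteq> 0"
      have "\<forall>i\<le>N. eval (?\<psi> (pd i g)) q = 0"
        by (rule rank[OF q rel]) (simp add: pdk)
      then show "eval (?\<psi> (pd l g)) q = 0" using True by blast
    qed
  qed
  then show "poly_vars (pd l g) \<subseteq> {..N} - {k} \<and> ?\<psi> (pd l g) = 0"
    using g poly_vars_pd[of l g] by blast
next
  fix c :: 'a
  assume "poly_vars (Const c) \<subseteq> {..N} - {k} \<and> psubst Const (\<lambda>i. pd i f) (Const c) = 0"
  then have "eval (Const c) (0\<^sub>v 0) = 0" by (simp add: Const.psubst_Const del: eval_Const)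
  then show "c = 0" by simp
qed (use g in auto)

text \<open>The polar image has codimension one if the partial derivatives satisfy an algebraic relation \<open>G\<close> and,
  at the general point, the rows with index different from \<open>k\<close> of the Hessian matrix are linearly
  independent.\<close>

lemma codim_polar_image_eq_1:
  fixes f :: "'a::{alg_closed_field, field_char_0} mpoly"
  assumes f: "is_form {..N} 3 f" and l: "l \<le> N" "pd l f \<noteq> 0" and k: "k \<le> N"
    and s: "poly_vars s \<subseteq> {..N}" "q \<in> carrier_vec (Suc N)" "eval s q \<noteq> 0"
    and rank: "\<And>p u. p \<in> proj_space N \<Longrightarrow> eval s p \<noteq> 0 \<Longrightarrow>
      (\<And>j. j \<le> N \<Longrightarrow> (\<Sum>i\<le>N. u i * eval (pd j (pd i f)) p) = 0) \<Longrightarrow> u k = 0 \<Longrightarrow> (\<forall>i\<le>N. u i = 0)"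
    and G: "poly_vars G \<subseteq> {..N}" "psubst Const (\<lambda>i. pd i f) G = 0" "G \<noteq> 0"
  shows "codim N (polar_image N f) = 1"
proof -
  let ?\<psi> = "psubst Const (\<lambda>i. pd i f)"
  let ?S = "{c \<cdot>\<^sub>v gradient N f p | c p. c \<noteq> 0 \<and> p \<in> proj_space N \<and> gradient N f p \<noteq> 0\<^sub>v (Suc N)}"
  have Z: "polar_image N f = zariski_closure N ?S" by (simp add: polar_image_def)
  have fv: "poly_vars (pd i f) \<subseteq> {..N}" for i
    using f poly_vars_pd[of i f] by (auto simp: is_form_iff)
  have psiv: "poly_vars (?\<psi> g) \<subseteq> {..N}" if "poly_vars g \<subseteq> {..N}" for g
    by (rule poly_vars_psubst_Const[OF that fv])
  \<comment> \<open>The scalar factor is redundant: it can be moved into \<open>p\<close> by means of a square root, because the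
    partial derivatives have degree 2.\<close>
  have S_eq: "?S = {gradient N f p | p. p \<in> proj_space N \<and> gradient N f p \<noteq> 0\<^sub>v (Suc N)}" (is "_ = ?S'")
  proof (intro equalityI subsetI)
    fix y assume "y \<in> ?S"
    then obtain c p where y: "y = c \<cdot>\<^sub>v gradient N f p" "c \<noteq> 0" "p \<in> proj_space N" "gradient N f p \<noteq> 0\<^sub>v (Suc N)" by blast
    obtain d where d: "d ^ 2 = c" using nth_root_exists[of 2 c] by auto
    have "gradient N f (d \<cdot>\<^sub>v p) = y"
    proof (rule eq_vecI)
      fix i assume "i < dim_vec y"
      then have "i < Suc N" using y by (simp add: gradient_def)
      moreover have "is_form {..N} 2 (pd i f)" using f by (intro is_form_pd) (simp add: numeral_3_eq_3 numeral_2_eq_2)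
      ultimately show "gradient N f (d \<cdot>\<^sub>v p) $ i = y $ i"
        using y eval_form_smult[of N 2 "pd i f" p d] d by (simp add: gradient_def proj_space_def)
    qed (use y in \<open>simp add: gradient_def\<close>)
    moreover have "d \<cdot>\<^sub>v p \<in> proj_space N" using d y by (intro proj_space_smult) auto
    moreover have "y \<in> proj_space N"
      unfolding y(1) by (rule proj_space_smult) (use y in \<open>auto simp: proj_space_def\<close>)
    ultimately show "y \<in> ?S'" by (auto simp: proj_space_def)
  next
    fix y assume "y \<in> ?S'"
    then show "y \<in> ?S" by (auto intro!: exI[of _ "1::'a"])
  qed
  have Sc: "c \<cdot>\<^sub>v v \<in> ?S" if "v \<in> ?S" "c \<noteq> 0" for v c
  proof -
    from that obtain d p where "v = d \<cdot>\<^sub>v gradient N f p" "d \<noteq> 0" "p \<in> proj_space N" "gradient N f p \<noteq> 0\<^sub>v (Suc N)" by blast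
    then show ?thesis using that by (auto simp: smult_smult_assoc intro!: exI[of _ "c * d"] exI[of _ p])
  qed
  have Sproj: "?S \<subseteq> proj_space N" unfolding S_eq by (auto simp: proj_space_def)
  obtain p1 where p1: "p1 \<in> carrier_vec (Suc N)" "eval (pd l f) p1 \<noteq> 0"
    using eq_0_if_eval_eq_0[OF fv, of l] l by blast
  have grad_nz: "gradient N f p \<in> ?S" if "p \<in> proj_space N" "eval (pd l f) p \<noteq> 0" for p
    unfolding S_eq using that l(1) by (auto simp: gradient_def vec_eq_iff less_Suc_eq_le)
  have irr: "irreducible_closed N (polar_image N f)"
    unfolding Z
  proof (rule irreducible_closed_closure[OF Sproj])
    obtain q where "q \<in> proj_space N" "eval (pd l f) q \<noteq> 0"
      using ex_common_nonzero_proj[OF fv p1 fv p1] by blast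
    then show "?S \<noteq> {}" using grad_nz by blast
    fix g h :: "'a mpoly" and d e
    assume gh: "is_form {..N} d g" "is_form {..N} e h" "\<forall>v\<in>?S. eval g v * eval h v = 0"
    show "(\<forall>v\<in>?S. eval g v = 0) \<or> (\<forall>v\<in>?S. eval h v = 0)"
    proof (rule ccontr)
      assume "\<not> ?thesis"
      then obtain p q where p: "p \<in> proj_space N" "eval g (gradient N f p) \<noteq> 0"
        and q: "q \<in> proj_space N" "eval h (gradient N f q) \<noteq> 0" unfolding S_eq by blast
      note gv = is_form_vars[OF gh(1)] and hv = is_form_vars[OF gh(2)]
      obtain u where u: "u \<in> proj_space N" "eval (?\<psi> g) u \<noteq> 0" "eval (?\<psi> h) u \<noteq> 0"
        using ex_common_nonzero_proj[OF psiv[OF gv], of p "?\<psi> h" q] psiv[OF hv] p q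
        by (auto simp: eval_psubst_gradient[OF gv] eval_psubst_gradient[OF hv] proj_space_def)
      have "poly_vars (?\<psi> g * ?\<psi> h) \<subseteq> {..N}"
        using poly_vars_mult psiv[OF gv] psiv[OF hv] by blast
      then obtain x where x: "x \<in> proj_space N" "eval (?\<psi> g * ?\<psi> h) x \<noteq> 0" "eval (pd l f) x \<noteq> 0"
        using ex_common_nonzero_proj[of "?\<psi> g * ?\<psi> h" N u "pd l f" p1] u p1 fv
        by (auto simp: eval.hom_mult proj_space_def)
      then show False
        using gh(3) grad_nz[OF x(1,3)]
        by (auto simp: eval.hom_mult eval_psubst_gradient[OF gv] eval_psubst_gradient[OF hv])
    qed
  qed
  have "polar_image N f \<noteq> proj_space N"
  proof
    assume eq: "polar_image N f = proj_space N"
    have GS: "eval G v = 0" if "v \<in> ?S" for v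
    proof -
      from that obtain p where "v = gradient N f p" unfolding S_eq by blast
      then show ?thesis using eval_psubst_gradient[OF G(1), of f p] G(2) by simp
    qed
    have "eval G v = 0" if "v \<in> proj_space N" for v
      using eval_eq_0_on_closure[OF Sproj Sc G(1) GS] that eq Z by blast
    then have "G = 0" by (intro eval_generic_eq_0[OF fv p1 G(1)])
    with G(3) show False by simp
  qed
  then show ?thesis
  proof (rule codim_eq_1[OF irr])
    fix W assume W: "irreducible_closed N W" "polar_image N f \<subseteq> W" "W \<noteq> proj_space N"
    show "W = polar_image N f"
    proof (rule no_intermediate_closed[OF k _ W])
      show "zariski_closed N (polar_image N f)" using irr by (simp add: irreducible_closed_def)
      fix c :: "'a mpoly" assume c: "poly_vars c \<subseteq> {..N} - {k}" "\<And>v. v \<in> polar_image N f \<Longrightarrow> eval c v = 0"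
      have cv: "poly_vars c \<subseteq> {..N}" using c by blast
      have psl: "?\<psi> c = 0"
      proof (rule eval_generic_eq_0[OF fv p1 psiv[OF cv]])
        fix q assume "q \<in> proj_space N" "eval (pd l f) q \<noteq> 0"
        then have "gradient N f q \<in> polar_image N f"
          using grad_nz subset_zariski_closure[of ?S N] unfolding Z by blast
        then show "eval (?\<psi> c) q = 0" using c(2) eval_psubst_gradient[OF cv] by simp
      qed
      show "c = 0"
        by (rule jacobian_criterion[OF is_form_vars[OF f] s _ c(1) psl]) (rule rank)
    qed
  qed
qed

section \<open>Linear algebra\<close>

lemma ex_nontrivial_solution:
  fixes A :: "'i \<Rightarrow> 'j \<Rightarrow> 'a::field"
  assumes "finite J" "finite I" "card J < card I"
  shows "\<exists>x. (\<exists>i\<in>I. x i \<noteq> 0) \<and> (\<forall>j\<in>J. (\<Sum>i\<in>I. x i * A i j) = 0)"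
  using assms
proof (induction J arbitrary: I A rule: finite_induct)
  case empty
  then have "I \<noteq> {}" by auto
  then show ?case by (intro exI[of _ "\<lambda>_. 1"]) auto
next
  case (insert j J)
  show ?case
  proof (cases "\<forall>i\<in>I. A i j = 0")
    case True
    from insert.IH[of I A] insert.prems insert.hyps
    obtain x where "\<exists>i\<in>I. x i \<noteq> 0" "\<forall>j\<in>J. (\<Sum>i\<in>I. x i * A i j) = 0" by auto
    then show ?thesis using True by (intro exI[of _ x]) simp
  next
    case False
    then obtain i0 where i0: "i0 \<in> I" "A i0 j \<noteq> 0" by blast
    define B where "B i l = A i l - A i j / A i0 j * A i0 l" for i l
    let ?I = "I - {i0}"
    have "card J < card ?I" using insert.prems insert.hyps i0 by simp
    then obtain x where x: "\<exists>i\<in>?I. x i \<noteq> 0" "\<forall>l\<in>J. (\<Sum>i\<in>?I. x i * B i l) = 0"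
      using insert.IH[of ?I B] insert.prems by blast
    define y where "y i = (if i = i0 then - (\<Sum>i\<in>?I. x i * A i j) / A i0 j else x i)" for i
    have y_sum: "(\<Sum>i\<in>I. y i * A i l) = (\<Sum>i\<in>?I. x i * B i l)" for l
    proof -
      have "(\<Sum>i\<in>I. y i * A i l) = y i0 * A i0 l + (\<Sum>i\<in>?I. y i * A i l)"
        using i0 insert.prems by (simp add: sum.remove)
      also have "(\<Sum>i\<in>?I. y i * A i l) = (\<Sum>i\<in>?I. x i * A i l)"
        by (rule sum.cong) (auto simp: y_def)
      also have "y i0 * A i0 l = - (\<Sum>i\<in>?I. x i * (A i j / A i0 j * A i0 l))"
        by (simp add: y_def sum_distrib_right sum_divide_distrib mult.assoc)
      finally show ?thesis
        by (simp add: B_def right_diff_distrib sum_subtractf)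
    qed
    have "(\<Sum>i\<in>?I. x i * B i j) = 0" using i0 by (simp add: B_def)
    then have "\<forall>l\<in>insert j J. (\<Sum>i\<in>I. y i * A i l) = 0" using x y_sum by auto
    moreover have "\<exists>i\<in>I. y i \<noteq> 0" using x by (auto simp: y_def)
    ultimately show ?thesis by blast
  qed
qed

lemma mult_mat_vec_index:
  "A \<in> carrier_mat n nc \<Longrightarrow> u \<in> carrier_vec nc \<Longrightarrow> i < n \<Longrightarrow> (A *\<^sub>v u) $ i = (\<Sum>j<nc. A $$ (i, j) * u $ j)"
  by (auto simp: scalar_prod_def lessThan_atLeast0 intro!: sum.cong)

lemma det_nonzero_inj:
  fixes A :: "'a::field mat"
  assumes "A \<in> carrier_mat n n" "det A \<noteq> 0"
    and "\<And>i. i < n \<Longrightarrow> (\<Sum>j<n. A $$ (i, j) * x j) = 0"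
  shows "\<forall>j<n. x j = 0"
proof -
  have "A *\<^sub>v vec n x = 0\<^sub>v n"
    by (rule eq_vecI) (use assms(1,3) in \<open>auto simp: mult_mat_vec_index simp del: index_mult_mat_vec\<close>)
  then have "vec n x = 0\<^sub>v n"
    using det_0_iff_vec_prod_zero_field[OF assms(1)] assms(2) vec_carrier[of n x] by blast
  then show ?thesis by (auto simp: vec_eq_iff)
qed

lemma det_nonzero_inj_left:
  fixes A :: "'a::field mat"
  assumes "A \<in> carrier_mat n n" "det A \<noteq> 0"
    and "\<And>j. j < n \<Longrightarrow> (\<Sum>i<n. x i * A $$ (i, j)) = 0"
  shows "\<forall>i<n. x i = 0"
proof (rule det_nonzero_inj)
  show "A\<^sup>T \<in> carrier_mat n n" "det A\<^sup>T \<noteq> 0" using assms det_transpose[OF assms(1)] by auto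
  show "(\<Sum>j<n. A\<^sup>T $$ (i, j) * x j) = 0" if "i < n" for i
    using assms(1) assms(3)[OF that] that by (auto simp: mult.commute intro!: sum.cong)
qed

lemma det_nonzero_if_inj:
  fixes A :: "'a::field mat"
  assumes "A \<in> carrier_mat n n"
    and "\<And>x. (\<And>i. i < n \<Longrightarrow> (\<Sum>j<n. A $$ (i, j) * x j) = 0) \<Longrightarrow> \<forall>j<n. x j = 0"
  shows "det A \<noteq> 0"
proof
  assume "det A = 0"
  then obtain v where v: "v \<in> carrier_vec n" "v \<noteq> 0\<^sub>v n" "A *\<^sub>v v = 0\<^sub>v n"
    using det_0_iff_vec_prod_zero_field[OF assms(1)] by blast
  have "(\<Sum>j<n. A $$ (i, j) * v $ j) = 0" if "i < n" for i
    using mult_mat_vec_index[OF assms(1) v(1) that] v(3) that by simp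
  then have "\<forall>j<n. v $ j = 0" by (rule assms(2))
  with v show False by (auto simp: vec_eq_iff)
qed

lemma distinct_cols_if_inj:
  fixes A :: "'a::field mat"
  assumes A: "A \<in> carrier_mat n nc"
    and inj: "\<And>u. u \<in> carrier_vec nc \<Longrightarrow> A *\<^sub>v u = 0\<^sub>v n \<Longrightarrow> u = 0\<^sub>v nc"
  shows "distinct (cols A)"
proof (rule ccontr)
  assume "\<not> distinct (cols A)"
  then obtain i j where ij: "i \<noteq> j" "i < nc" "j < nc" "col A i = col A j"
    using A by (auto simp: distinct_conv_nth)
  let ?u = "unit_vec nc i - unit_vec nc j :: 'a vec"
  have "A *\<^sub>v ?u = A *\<^sub>v unit_vec nc i - A *\<^sub>v unit_vec nc j"
    by (rule mult_minus_distrib_mat_vec[OF A]) auto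
  also have "\<dots> = col A i - col A j"
    using A ij(1-3) by (intro arg_cong2[where f = "(-)"] eq_vecI) auto
  also have "\<dots> = 0\<^sub>v n" using A ij by simp
  finally have "?u = 0\<^sub>v nc" by (intro inj) auto
  then have "?u $ i = 0" using ij by simp
  then show False using ij by simp
qed

lemma lin_indpt_cols_if_inj:
  fixes A :: "'a::field mat"
  assumes A: "A \<in> carrier_mat n nc"
    and inj: "\<And>u. u \<in> carrier_vec nc \<Longrightarrow> A *\<^sub>v u = 0\<^sub>v n \<Longrightarrow> u = 0\<^sub>v nc"
  shows "\<not> module.lin_dep class_ring (module_vec TYPE('a) n) (set (cols A))"
proof
  interpret vec_space "TYPE('a)" n .
  assume "lin_dep (set (cols A))"
  from lin_depE[OF A this distinct_cols_if_inj[OF A inj]] inj show False by metis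
qed

lemma rank_eq_ncols_iff:
  fixes A :: "'a::field mat"
  assumes A: "A \<in> carrier_mat n nc"
  shows "vec_space.rank n A = nc \<longleftrightarrow> (\<forall>u\<in>carrier_vec nc. A *\<^sub>v u = 0\<^sub>v n \<longrightarrow> u = 0\<^sub>v nc)"
proof
  interpret vec_space "TYPE('a)" n .
  assume "\<forall>u\<in>carrier_vec nc. A *\<^sub>v u = 0\<^sub>v n \<longrightarrow> u = 0\<^sub>v nc"
  then show "rank A = nc"
    using lin_indpt_full_rank[OF A distinct_cols_if_inj[OF A] lin_indpt_cols_if_inj[OF A]] by blast
next
  interpret vec_space "TYPE('a)" n .
  assume rank: "rank A = nc"
  obtain S where S: "maximal S (\<lambda>T. T \<subseteq> set (cols A) \<and> lin_indpt T)"
    using maximal_exists[of "(\<lambda>T. T \<subseteq> set (cols A) \<and> lin_indpt T)" "card (set (cols A))" "{}"]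
    by (meson List.finite_set card_mono empty_iff empty_subsetI finite_lin_indpt2 rev_finite_subset)
  then have "nc \<le> card (set (cols A))"
    using rank_card_indpt[OF A S] rank by (simp add: card_mono maximal_def)
  then have distinct: "distinct (cols A)"
    using A card_length[of "cols A"] by (intro card_distinct) simp
  then have "lin_indpt (set (cols A))" using full_rank_lin_indpt[OF A rank] by blast
  then show "\<forall>u\<in>carrier_vec nc. A *\<^sub>v u = 0\<^sub>v n \<longrightarrow> u = 0\<^sub>v nc"
    using lin_depI[OF A _ _ _ distinct] by blast
qed

text \<open>The rank is at least the number of columns selected by \<open>\<sigma>\<close>, if these are linearly independent.\<close>

lemma rank_ge_if_indpt_cols:
  fixes A :: "'a::field mat"
  assumes A: "A \<in> carrier_mat n nc" and \<sigma>: "inj_on \<sigma> {..<r}" "\<sigma> ` {..<r} \<subseteq> {..<nc}"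
    and inj: "\<And>x. (\<And>i. i < n \<Longrightarrow> (\<Sum>j<nc. A $$ (i, j) * x j) = 0) \<Longrightarrow>
      (\<And>j. j \<notin> \<sigma> ` {..<r} \<Longrightarrow> x j = 0) \<Longrightarrow> \<forall>j<nc. x j = 0"
  shows "r \<le> vec_space.rank n A"
proof -
  interpret vec_space "TYPE('a)" n .
  define B where "B = mat n r (\<lambda>(i, j). A $$ (i, \<sigma> j))"
  have B: "B \<in> carrier_mat n r" by (simp add: B_def)
  have injB: "u = 0\<^sub>v r" if u: "u \<in> carrier_vec r" "B *\<^sub>v u = 0\<^sub>v n" for u
  proof -
    define x where "x j = (if j \<in> \<sigma> ` {..<r} then u $ (the_inv_into {..<r} \<sigma> j) else 0)" for j
    have x: "x (\<sigma> j) = u $ j" if "j < r" for j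
      using that the_inv_into_f_f[OF \<sigma>(1)] by (auto simp: x_def)
    have "(\<Sum>j<nc. A $$ (i, j) * x j) = 0" if "i < n" for i
    proof -
      have "(\<Sum>j<nc. A $$ (i, j) * x j) = (\<Sum>j\<in>\<sigma> ` {..<r}. A $$ (i, j) * x j)"
        by (rule sum.mono_neutral_right) (use \<sigma> in \<open>auto simp: x_def\<close>)
      also have "\<dots> = (\<Sum>j<r. A $$ (i, \<sigma> j) * u $ j)"
        using x by (simp add: sum.reindex[OF \<sigma>(1)])
      also have "\<dots> = (B *\<^sub>v u) $ i"
        using that by (subst mult_mat_vec_index[OF B u(1) that]) (simp add: B_def)
      finally show ?thesis using u that by simp
    qed
    moreover have "x j = 0" if "j \<notin> \<sigma> ` {..<r}" for j using that by (simp add: x_def)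
    ultimately have "\<forall>j<nc. x j = 0" by (rule inj)
    then have "u $ j = 0" if "j < r" for j using x[OF that] \<sigma>(2) that by auto
    then show ?thesis using u by (intro eq_vecI) auto
  qed
  have "set (cols B) \<subseteq> set (cols A)"
  proof
    fix v assume "v \<in> set (cols B)"
    then obtain j where j: "j < r" "v = col B j" using B by (auto simp: in_set_conv_nth)
    have "col B j = col A (\<sigma> j)"
      by (rule eq_vecI) (use A j \<sigma>(2) in \<open>auto simp: B_def\<close>)
    moreover have "\<sigma> j < nc" using j \<sigma>(2) by blast
    ultimately show "v \<in> set (cols A)" using A j by (auto simp: in_set_conv_nth)
  qed
  then have "card (set (cols B)) \<le> rank A"
    using lin_indpt_cols_if_inj[OF B injB] by (intro rank_ge_card_indpt[OF A]) auto
  then show ?thesis using distinct_card[OF distinct_cols_if_inj[OF B injB]] B by simp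
qed

text \<open>The square matrix that arises from the \<open>t + 1\<close> by \<open>t\<close> matrix \<open>J\<close> by adding, as last column, the unit
  vector with index \<open>k\<close>. For \<open>k \<le> t\<close> its determinant is, up to sign, the minor of \<open>J\<close> without the row \<open>k\<close>.\<close>

definition border :: "nat \<Rightarrow> nat \<Rightarrow> (nat \<Rightarrow> nat \<Rightarrow> 'a::zero_neq_one) \<Rightarrow> 'a mat" where
  "border t k J = mat (Suc t) (Suc t) (\<lambda>(i, j). if j < t then J i j else if i = k then 1 else 0)"

lemma border_carrier [simp]: "border t k J \<in> carrier_mat (Suc t) (Suc t)"
  by (simp add: border_def)

text \<open>The index \<open>k\<close> is chosen such that a nonzero left kernel vector \<open>y\<close> of \<open>J\<close> has a nonzero coordinate
  \<open>y k\<close>.\<close>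

lemma ex_border_det_nonzero:
  fixes J :: "nat \<Rightarrow> nat \<Rightarrow> 'a::field"
  assumes inj: "\<And>x. (\<And>i. i \<le> t \<Longrightarrow> (\<Sum>j<t. J i j * x j) = 0) \<Longrightarrow> \<forall>j<t. x j = 0"
  shows "\<exists>k\<le>t. det (border t k J) \<noteq> 0"
proof -
  obtain y where y: "\<exists>i\<in>{..t}. y i \<noteq> 0" "\<forall>j\<in>{..<t}. (\<Sum>i\<le>t. y i * J i j) = 0"
    using ex_nontrivial_solution[of "{..<t}" "{..t}" J] by auto
  then obtain k where k: "k \<le> t" "y k \<noteq> 0" by auto
  have "det (border t k J) \<noteq> 0"
  proof (rule det_nonzero_if_inj[OF border_carrier])
    fix x assume sol: "\<And>i. i < Suc t \<Longrightarrow> (\<Sum>j<Suc t. border t k J $$ (i, j) * x j) = 0"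
    have x: "(\<Sum>j<t. J i j * x j) + (if i = k then x t else 0) = 0" if "i \<le> t" for i
    proof -
      have "(\<Sum>j<t. border t k J $$ (i, j) * x j) = (\<Sum>j<t. J i j * x j)"
        using that by (intro sum.cong) (auto simp: border_def)
      then show ?thesis using sol[of i] that by (cases "i = k") (simp_all add: border_def)
    qed
    have "0 = (\<Sum>i\<le>t. y i * ((\<Sum>j<t. J i j * x j) + (if i = k then x t else 0)))"
      using x by simp
    also have "\<dots> = (\<Sum>i\<le>t. y i * (\<Sum>j<t. J i j * x j) + (if i = k then y k * x t else 0))"
      by (rule sum.cong) (auto simp: distrib_left)
    also have "\<dots> = (\<Sum>i\<le>t. \<Sum>j<t. y i * J i j * x j) + (\<Sum>i\<le>t. if i = k then y k * x t else 0)"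
      by (simp add: sum.distrib sum_distrib_left mult.assoc)
    also have "(\<Sum>i\<le>t. \<Sum>j<t. y i * J i j * x j) = (\<Sum>j<t. (\<Sum>i\<le>t. y i * J i j) * x j)"
      by (subst sum.swap) (simp add: sum_distrib_right)
    finally have xt: "x t = 0" using y(2) k by simp
    have "(\<Sum>j<t. J i j * x j) = 0" if "i \<le> t" for i
      using x[OF that] xt by (cases "i = k") simp_all
    then have "\<forall>j<t. x j = 0" by (rule inj)
    with xt show "\<forall>j<Suc t. x j = 0" by (auto simp: less_Suc_eq)
  qed
  with k show ?thesis by blast
qed

lemma border_det_nonzero_left:
  fixes J :: "nat \<Rightarrow> nat \<Rightarrow> 'a::field"
  assumes "det (border t k J) \<noteq> 0" "k \<le> t"
    and "\<And>j. j < t \<Longrightarrow> (\<Sum>i\<le>t. u i * J i j) = 0" "u k = 0"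
  shows "\<forall>i\<le>t. u i = 0"
proof -
  have "(\<Sum>i<Suc t. u i * border t k J $$ (i, j)) = 0" if j: "j < Suc t" for j
  proof -
    have "(\<Sum>i<Suc t. u i * border t k J $$ (i, j)) =
        (\<Sum>i\<le>t. if j < t then u i * J i j else if i = k then u k else 0)"
      using j by (intro sum.cong) (auto simp: border_def)
    also have "\<dots> = (if j < t then \<Sum>i\<le>t. u i * J i j else u k)"
      using assms(2) by simp
    finally show ?thesis using assms(3,4) by simp
  qed
  from det_nonzero_inj_left[OF border_carrier assms(1) this] show ?thesis by (simp add: less_Suc_eq_le)
qed

lemma det_in_subring:
  assumes R: "subring_set R" and A: "A \<in> carrier_mat n n" "\<And>i j. i < n \<Longrightarrow> j < n \<Longrightarrow> A $$ (i, j) \<in> R"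
  shows "det A \<in> R"
proof -
  have prod: "(\<Prod>i\<in>S. g i) \<in> R" if "\<And>i. i \<in> S \<Longrightarrow> g i \<in> R" for S :: "nat set" and g
    using that by (induction S rule: infinite_finite_induct) (use R in \<open>auto simp: subring_set_def\<close>)
  have m1: "- 1 \<in> R" using R unfolding subring_set_def by (metis diff_0)
  have "(\<Prod>i = 0..<n. A $$ (i, p i)) \<in> R" if "p permutes {0..<n}" for p
    by (rule prod) (use A(2) permutes_in_image[OF that] in auto)
  then show ?thesis
    unfolding det_def'[OF A(1)]
    by (intro subring_set_sum[OF R]) (use R m1 in \<open>auto simp: subring_set_def sign_def\<close>)
qed

text \<open>A permutation cannot map the \<open>a\<close> rows of the block of zeros into the \<open>n - b < a\<close> columns that do not meet it,
  so that every summand of the determinant contains a zero.\<close>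

lemma det_eq_0_if_zero_block:
  fixes A :: "'a::comm_ring_1 mat"
  assumes A: "A \<in> carrier_mat n n" "\<And>i j. i < a \<Longrightarrow> j < b \<Longrightarrow> A $$ (i, j) = 0"
    and ab: "a \<le> n" "b \<le> n" "n < a + b"
  shows "det A = 0"
  unfolding det_def'[OF A(1)]
proof (intro sum.neutral ballI)
  fix p assume "p \<in> {p. p permutes {0..<n}}"
  then have p: "p permutes {0..<n}" by simp
  have "\<exists>i<a. p i < b"
  proof (rule ccontr)
    assume "\<not> ?thesis"
    then have "p ` {0..<a} \<subseteq> {b..<n}" using permutes_in_image[OF p] ab by (fastforce simp: not_less)
    from card_mono[OF _ this] have "a \<le> n - b"
      using card_image[OF inj_on_subset[OF permutes_inj_on[OF p]], of "{0..<a}" "UNIV"] by simp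
    with ab show False by simp
  qed
  then obtain i where "i < a" "p i < b" by blast
  then have "(\<Prod>i = 0..<n. A $$ (i, p i)) = 0"
    using A(2) ab by (intro prod_zero bexI[of _ i]) auto
  then show "signof p * (\<Prod>i = 0..<n. A $$ (i, p i)) = 0" by simp
qed

section \<open>Algebraic dependence of more forms than variables\<close>

lemma is_form_power: "is_form I d g \<Longrightarrow> is_form I (d * n) (g ^ n :: 'a::comm_ring_1 mpoly)"
proof (induction n)
  case 0
  then show ?case using is_form_Const[of I "1 :: 'a"] by simp
next
  case (Suc n)
  then show ?case using is_form_mult[of I d g "d * n" "g ^ n"] by simp
qed

lemma is_form_prod: "finite S \<Longrightarrow> (\<And>x. x \<in> S \<Longrightarrow> is_form I (d x) (g x)) \<Longrightarrow>
    is_form I (\<Sum>x\<in>S. d x) (\<Prod>x\<in>S. g x :: 'a::comm_ring_1 mpoly)"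
proof (induction S rule: finite_induct)
  case empty
  then show ?case using is_form_Const[of I "1 :: 'a"] by simp
next
  case (insert x S)
  then show ?case using is_form_mult[of I "d x" "g x" "\<Sum>x\<in>S. d x" "\<Prod>x\<in>S. g x"] by simp
qed

lemma lookup_sum_single_nat:
  "finite S \<Longrightarrow> Poly_Mapping.lookup (\<Sum>i\<in>S. Poly_Mapping.single i (a i :: nat)) i = (if i \<in> S then a i else 0)"
  by (simp add: lookup_sum lookup_single when_def)

lemma lookup_le_mdeg: "Poly_Mapping.lookup m i \<le> mdeg m"
proof (cases "i \<in> Poly_Mapping.keys m")
  case True
  then show ?thesis unfolding mdeg_def by (intro member_le_sum) auto
qed (simp add: in_keys_iff)

text \<open>More forms of the same degree \<open>d\<close> than variables are algebraically dependent. The \<open>K ^ (t + 1)\<close> products of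
  powers with exponents less than \<open>K\<close> are linear combinations of at most \<open>(D + 1) ^ t\<close> monomials, where
  \<open>D = d (t + 1) K\<close>, and the first number exceeds the second one for \<open>K\<close> large enough.\<close>

lemma ex_algebraic_relation:
  fixes C :: "nat \<Rightarrow> 'a::field mpoly"
  assumes V: "finite V" "card V \<le> t" and C: "\<And>i. i \<le> t \<Longrightarrow> is_form V d (C i)"
  shows "\<exists>G. G \<noteq> 0 \<and> poly_vars G \<subseteq> {..t} \<and> psubst Const C G = 0"
proof -
  define B where "B = d * (t + 1) + 1"
  define K where "K = B ^ t + 1"
  define D where "D = d * (t + 1) * K"
  define I where "I = PiE {..t} (\<lambda>_. {..<K})"
  define J where "J = {m :: nat \<Rightarrow>\<^sub>0 nat. Poly_Mapping.keys m \<subseteq> V \<and> (\<forall>i. Poly_Mapping.lookup m i \<le> D)}"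
  define \<mu> where "\<mu> a = (\<Sum>i\<le>t. Poly_Mapping.single i (a i))" for a :: "nat \<Rightarrow> nat"
  have lookup_\<mu>: "Poly_Mapping.lookup (\<mu> a) i = (if i \<le> t then a i else 0)" for a i
    by (simp add: \<mu>_def lookup_sum_single_nat)
  have inj_\<mu>: "inj_on \<mu> I"
  proof (rule inj_onI)
    fix a b assume ab: "a \<in> I" "b \<in> I" "\<mu> a = \<mu> b"
    show "a = b"
    proof (rule PiE_ext[OF ab(1,2)[unfolded I_def]])
      fix i assume "i \<in> {..t}"
      then show "a i = b i" using arg_cong[OF ab(3), of "\<lambda>m. Poly_Mapping.lookup m i"] lookup_\<mu> by simp
    qed
  qed
  have finI: "finite I" and cardI: "card I = K ^ (t + 1)"
    by (simp_all add: I_def finite_PiE card_PiE)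
  have inj_J: "inj_on (\<lambda>m. restrict (Poly_Mapping.lookup m) V) J"
  proof (rule inj_onI)
    fix m m' assume m: "m \<in> J" "m' \<in> J" "restrict (Poly_Mapping.lookup m) V = restrict (Poly_Mapping.lookup m') V"
    have "Poly_Mapping.lookup m i = Poly_Mapping.lookup m' i" if "i \<in> V" for i
      using fun_cong[OF m(3), of i] that by simp
    moreover have "Poly_Mapping.lookup k i = 0" if "i \<notin> V" "k \<in> J" for i k
      using that unfolding J_def by (metis (no_types, lifting) in_keys_iff mem_Collect_eq subsetD)
    ultimately show "m = m'"
      using m(1,2) by (intro poly_mapping_eqI) metis
  qed
  have J_sub: "(\<lambda>m. restrict (Poly_Mapping.lookup m) V) ` J \<subseteq> PiE V (\<lambda>_. {..D})"
    by (auto simp: J_def)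
  have finJ: "finite J"
    by (rule finite_imageD[OF finite_subset[OF J_sub] inj_J]) (simp add: finite_PiE V)
  have "card J \<le> card (PiE V (\<lambda>_. {..D}))"
    using card_mono[OF _ J_sub] V by (simp add: card_image[OF inj_J] finite_PiE)
  also have "\<dots> = (D + 1) ^ card V" using V by (simp add: card_PiE)
  also have "\<dots> \<le> (D + 1) ^ t" using V by (intro power_increasing) auto
  also have "\<dots> \<le> (B * K) ^ t"
    by (intro power_mono) (auto simp: B_def D_def K_def algebra_simps)
  also have "\<dots> = B ^ t * K ^ t" by (simp add: power_mult_distrib)
  also have "\<dots> < K * K ^ t" by (rule mult_strict_right_mono) (auto simp: K_def)
  finally have card: "card J < card I" by (simp add: cardI)
  obtain x where x: "\<exists>a\<in>I. x a \<noteq> 0"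
    "\<forall>m\<in>J. (\<Sum>a\<in>I. x a * Poly_Mapping.lookup (mon_eval C (\<mu> a)) m) = 0"
    using ex_nontrivial_solution[OF finJ finI card, of "\<lambda>a m. Poly_Mapping.lookup (mon_eval C (\<mu> a)) m"] by blast
  define G where "G = (\<Sum>a\<in>I. Poly_Mapping.single (\<mu> a) (x a))"
  have lookup_G: "Poly_Mapping.lookup G (\<mu> b) = x b" if "b \<in> I" for b
  proof -
    have "Poly_Mapping.lookup G (\<mu> b) = (\<Sum>a\<in>I. if a = b then x b else 0)"
      unfolding G_def lookup_sum
      by (rule sum.cong) (use that inj_\<mu> in \<open>auto simp: lookup_single when_def inj_on_def\<close>)
    then show ?thesis using that finI by simp
  qed
  have "G \<noteq> 0" using x(1) lookup_G by (metis lookup_zero)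
  moreover have "poly_vars G \<subseteq> {..t}"
  proof -
    have "poly_vars (Poly_Mapping.single (\<mu> a) (x a)) \<subseteq> {..t}" for a
      by (auto simp: poly_vars_def in_keys_iff lookup_\<mu> split: if_splits)
    then show ?thesis unfolding G_def using poly_vars_sum by blast
  qed
  moreover have "psubst Const C G = 0"
  proof (rule poly_mapping_eqI)
    fix m
    have eq: "Poly_Mapping.lookup (psubst Const C G) m = (\<Sum>a\<in>I. x a * Poly_Mapping.lookup (mon_eval C (\<mu> a)) m)"
      by (simp add: G_def psubst_Const.hom_sum Const.psubst_single lookup_sum lookup_Const_mult)
    show "Poly_Mapping.lookup (psubst Const C G) m = Poly_Mapping.lookup 0 m"
    proof (cases "m \<in> J")
      case True
      then show ?thesis using eq x(2) by simp
    next
      case False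
      have "Poly_Mapping.lookup (mon_eval C (\<mu> a)) m = 0" if a: "a \<in> I" for a
      proof (rule ccontr)
        assume "Poly_Mapping.lookup (mon_eval C (\<mu> a)) m \<noteq> 0"
        then have m: "m \<in> Poly_Mapping.keys (mon_eval C (\<mu> a))" by (simp add: in_keys_iff)
        have "mon_eval C (\<mu> a) = (\<Prod>i\<le>t. C i ^ a i)"
          by (subst mon_eval_superset[of "{..t}"]) (auto simp: lookup_\<mu> in_keys_iff split: if_splits)
        then have form: "is_form V (\<Sum>i\<le>t. d * a i) (mon_eval C (\<mu> a))"
          using C by (auto intro!: is_form_prod is_form_power)
        have "(\<Sum>i\<le>t. d * a i) \<le> (\<Sum>i\<le>t. d * K)"
          by (intro sum_mono mult_left_mono) (use a in \<open>auto simp: I_def PiE_iff less_imp_le\<close>)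
        then have "mdeg m \<le> D" using form m by (auto simp: is_form_iff D_def algebra_simps)
        then have "m \<in> J"
          using form m lookup_le_mdeg[of m] by (auto simp: J_def is_form_iff poly_vars_def intro: order.trans)
        with False show False by simp
      qed
      then show ?thesis using eq by simp
    qed
  qed
  ultimately show ?thesis by blast
qed

section \<open>Quadrics\<close>

lemma eval_quadratic_form:
  "eval (quadratic_form N A) (v :: 'a::comm_ring_1 vec) = (\<Sum>i\<le>N. \<Sum>j\<le>N. A $$ (i, j) * v $ i * v $ j)"
  by (simp add: quadratic_form_def eval.hom_sum eval.hom_mult)

lemma eval_pd_quadratic_form:
  fixes v :: "'a::comm_ring_1 vec"
  assumes sym: "\<And>i j. i \<le> N \<Longrightarrow> j \<le> N \<Longrightarrow> A $$ (i, j) = A $$ (j, i)" and k: "k \<le> N"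
  shows "eval (pd k (quadratic_form N A)) v = 2 * (\<Sum>j\<le>N. A $$ (k, j) * v $ j)"
proof -
  have *: "eval (pd k (Const (A $$ (i, j)) * Var i * Var j)) v =
      (if i = k then A $$ (k, j) * v $ j else 0) + (if j = k then A $$ (i, k) * v $ i else 0)" for i j
    by (simp add: pd_mult pd_Var eval.hom_add eval.hom_mult)
  have "eval (pd k (quadratic_form N A)) v =
      (\<Sum>i\<le>N. \<Sum>j\<le>N. if i = k then A $$ (k, j) * v $ j else 0) +
      (\<Sum>i\<le>N. \<Sum>j\<le>N. if j = k then A $$ (i, k) * v $ i else 0)"
    by (simp add: quadratic_form_def pd_sum eval.hom_sum * sum.distrib)
  also have "(\<Sum>i\<le>N. \<Sum>j\<le>N. if i = k then A $$ (k, j) * v $ j else 0) = (\<Sum>j\<le>N. A $$ (k, j) * v $ j)"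
    by (subst sum.swap) (use k in simp)
  also have "(\<Sum>i\<le>N. \<Sum>j\<le>N. if j = k then A $$ (i, k) * v $ i else 0) = (\<Sum>i\<le>N. A $$ (k, i) * v $ i)"
    using k sym by simp
  finally show ?thesis by simp
qed

lemma quadric_tangent_space_iff:
  fixes v :: "'a::field_char_0 vec"
  assumes sym: "\<And>i j. i \<le> N \<Longrightarrow> j \<le> N \<Longrightarrow> A $$ (i, j) = A $$ (j, i)"
  shows "v \<in> quadric_tangent_space N A m \<longleftrightarrow>
    v \<in> proj_space N \<and> (\<Sum>i\<le>N. \<Sum>j\<le>N. A $$ (i, j) * m $ j * v $ i) = 0"
proof -
  have "(\<Sum>i\<le>N. eval (pd i (quadratic_form N A)) m * v $ i) = 2 * (\<Sum>i\<le>N. \<Sum>j\<le>N. A $$ (i, j) * m $ j * v $ i)"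
    by (simp add: eval_pd_quadratic_form[OF sym] sum_distrib_left sum_distrib_right mult.assoc)
  then show ?thesis by (simp add: quadric_tangent_space_def tangent_space_def)
qed

lemma Vert_iff:
  fixes v :: "'a::field_char_0 vec"
  assumes sym: "\<And>i j. i \<le> N \<Longrightarrow> j \<le> N \<Longrightarrow> A $$ (i, j) = A $$ (j, i)"
  shows "v \<in> Vert N A \<longleftrightarrow> v \<in> proj_space N \<and> (\<forall>i\<le>N. (\<Sum>j\<le>N. A $$ (i, j) * v $ j) = 0)"
proof -
  have "eval (quadratic_form N A) v = (\<Sum>i\<le>N. v $ i * (\<Sum>j\<le>N. A $$ (i, j) * v $ j))"
    by (simp add: eval_quadratic_form sum_distrib_left mult_ac)
  then show ?thesis
    by (auto simp: Vert_def sing_def zeros_def eval_pd_quadratic_form[OF sym])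
qed

lemma linear_space_coordinates:
  fixes a :: nat
  assumes "a \<le> N"
  shows "linear_space N a (zeros N (Var ` {a + 1..N}) :: 'a::field vec set)"
proof -
  define B :: "'a mat" where "B = mat (Suc N) (Suc a) (\<lambda>(i, j). if i = j then 1 else 0)"
  have B: "B \<in> carrier_mat (Suc N) (Suc a)" by (simp add: B_def)
  have Bu: "(B *\<^sub>v u) $ i = (if i \<le> a then u $ i else 0)" if "u \<in> carrier_vec (Suc a)" "i \<le> N" for u i
  proof -
    have "(B *\<^sub>v u) $ i = (\<Sum>j<Suc a. B $$ (i, j) * u $ j)"
      using that by (intro mult_mat_vec_index[OF B]) auto
    also have "\<dots> = (\<Sum>j<Suc a. if j = i then u $ i else 0)"
      by (rule sum.cong) (use that in \<open>auto simp: B_def\<close>)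
    also have "\<dots> = (if i \<le> a then u $ i else 0)"
      by (subst sum.delta) auto
    finally show ?thesis .
  qed
  have "u = 0\<^sub>v (Suc a)" if u: "u \<in> carrier_vec (Suc a)" "B *\<^sub>v u = 0\<^sub>v (Suc N)" for u
  proof (rule eq_vecI)
    fix i assume "i < dim_vec (0\<^sub>v (Suc a) :: 'a vec)"
    then show "u $ i = 0\<^sub>v (Suc a) $ i" using Bu[OF u(1), of i] u(2) assms by auto
  qed (use u in simp)
  then have "vec_space.rank (Suc N) B = Suc a" using rank_eq_ncols_iff[OF B] by blast
  moreover have "zeros N (Var ` {a + 1..N}) = {v \<in> proj_space N. \<exists>u \<in> carrier_vec (Suc a). v = B *\<^sub>v u}"
  proof (intro equalityI subsetI)
    fix v :: "'a vec" assume v: "v \<in> zeros N (Var ` {a + 1..N})"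
    have "v = B *\<^sub>v vec (Suc a) (\<lambda>i. v $ i)"
    proof (rule eq_vecI)
      fix i assume "i < dim_vec (B *\<^sub>v vec (Suc a) (\<lambda>i. v $ i))"
      then have "i \<le> N" using B by simp
      then show "v $ i = (B *\<^sub>v vec (Suc a) (\<lambda>i. v $ i)) $ i"
        using Bu[of "vec (Suc a) (\<lambda>i. v $ i)" i] v by (auto simp: zeros_def)
    qed (use v B in \<open>simp add: zeros_def proj_space_def\<close>)
    then show "v \<in> {v \<in> proj_space N. \<exists>u \<in> carrier_vec (Suc a). v = B *\<^sub>v u}"
      using v by (auto simp: zeros_def intro!: bexI[of _ "vec (Suc a) (\<lambda>i. v $ i)"])
  next
    fix v :: "'a vec" assume "v \<in> {v \<in> proj_space N. \<exists>u \<in> carrier_vec (Suc a). v = B *\<^sub>v u}"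
    then show "v \<in> zeros N (Var ` {a + 1..N})" using Bu by (auto simp: zeros_def)
  qed
  ultimately show ?thesis unfolding linear_space_def using B by blast
qed

section \<open>Polar quadrics with a common block of zeros\<close>

lemma polar_quadric_index:
  "i \<le> N \<Longrightarrow> j \<le> N \<Longrightarrow> polar_quadric N f p $$ (i, j) = eval (pd i (pd j f)) p"
  by (simp add: polar_quadric_def hessian_def)

lemma polar_quadric_sym:
  "i \<le> N \<Longrightarrow> j \<le> N \<Longrightarrow> polar_quadric N f (p :: 'a::comm_ring_1 vec) $$ (i, j) = polar_quadric N f p $$ (j, i)"
  by (simp add: polar_quadric_index pd_commute)

lemma polar_quadric_carrier [simp]: "polar_quadric N f p \<in> carrier_mat (Suc N) (Suc N)"
  by (simp add: polar_quadric_def hessian_def)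

lemma coordinate_space_iff:
  "v \<in> zeros N (Var ` {a..N}) \<longleftrightarrow> v \<in> proj_space N \<and> (\<forall>i\<in>{a..N}. (v :: 'a::comm_ring_1 vec) $ i = 0)"
  by (auto simp: zeros_def)

lemma zero_block_tangent:
  fixes A :: "'a::field_char_0 mat"
  assumes \<tau>: "\<tau> \<le> N - \<tau>"
    and sym: "\<And>i j. i \<le> N \<Longrightarrow> j \<le> N \<Longrightarrow> A $$ (i, j) = A $$ (j, i)"
    and block: "\<And>i j. i \<le> \<tau> \<Longrightarrow> j \<le> N - \<tau> \<Longrightarrow> A $$ (i, j) = 0"
  defines "M \<equiv> (zeros N (Var ` {\<tau> + 1..N}) :: 'a vec set)"
    and "L \<equiv> (zeros N (Var ` {N - \<tau> + 1..N}) :: 'a vec set)"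
  shows "M \<subseteq> quadric N A" and "tangent_along N A L M"
proof -
  have M_sub_L: "M \<subseteq> L" using \<tau> by (auto simp: M_def L_def coordinate_space_iff)
  have 0: "A $$ (i, j) * m $ j * v $ i = 0" if "m \<in> M" "v \<in> L" "i \<le> N" "j \<le> N" for m v i j
  proof (cases "j \<le> \<tau> \<and> i \<le> N - \<tau>")
    case True
    then show ?thesis using block[of j i] sym[of i j] that by simp
  next
    case False
    then show ?thesis using that by (auto simp: M_def L_def coordinate_space_iff)
  qed
  have proj: "M \<subseteq> proj_space N" "L \<subseteq> proj_space N" by (auto simp: M_def L_def zeros_def)
  show "M \<subseteq> quadric N A"
  proof
    fix m assume m: "m \<in> M"
    have "eval (quadratic_form N A) m = (\<Sum>i\<le>N. \<Sum>j\<le>N. A $$ (i, j) * m $ j * m $ i)"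
      by (simp add: eval_quadratic_form mult_ac)
    also have "\<dots> = 0" using 0[OF m subsetD[OF M_sub_L m]] by (intro sum.neutral ballI) simp
    finally show "m \<in> quadric N A" using m proj by (auto simp: quadric_def zeros_def)
  qed
  have "L \<subseteq> quadric_tangent_space N A m" if m: "m \<in> M" for m
  proof
    fix v assume v: "v \<in> L"
    have "(\<Sum>i\<le>N. \<Sum>j\<le>N. A $$ (i, j) * m $ j * v $ i) = 0"
      using 0[OF m v] by (intro sum.neutral ballI) simp
    with v proj show "v \<in> quadric_tangent_space N A m"
      by (auto simp: quadric_tangent_space_iff[OF sym])
  qed
  moreover have "linear_space N (N - \<tau>) L" unfolding L_def by (rule linear_space_coordinates) simp
  ultimately show "tangent_along N A L M" unfolding tangent_along_def using M_sub_L by blast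
qed

text \<open>The bilinear form of \<open>A\<close> is evaluated at a coordinate point of \<open>M\<close> and one of \<open>L\<close>.\<close>

lemma tangent_zero_block:
  fixes A :: "'a::field_char_0 mat"
  assumes sym: "\<And>i j. i \<le> N \<Longrightarrow> j \<le> N \<Longrightarrow> A $$ (i, j) = A $$ (j, i)"
    and tang: "tangent_along N A (zeros N (Var ` {N - \<tau> + 1..N})) (zeros N (Var ` {\<tau> + 1..N}))"
    and ij: "i \<le> \<tau>" "j \<le> N - \<tau>" "\<tau> \<le> N"
  shows "A $$ (i, j) = 0"
proof -
  have "unit_vec (Suc N) i \<in> zeros N (Var ` {\<tau> + 1..N} :: 'a mpoly set)"
    using ij by (auto simp: coordinate_space_iff proj_space_iff intro!: exI[of _ i])
  moreover have "unit_vec (Suc N) j \<in> zeros N (Var ` {N - \<tau> + 1..N} :: 'a mpoly set)"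
    using ij by (auto simp: coordinate_space_iff proj_space_iff intro!: exI[of _ j])
  ultimately have "unit_vec (Suc N) j \<in> quadric_tangent_space N A (unit_vec (Suc N) i)"
    using tang unfolding tangent_along_def by blast
  then have "0 = (\<Sum>k\<le>N. \<Sum>l\<le>N. A $$ (k, l) * unit_vec (Suc N) i $ l * unit_vec (Suc N) j $ k)"
    by (simp only: quadric_tangent_space_iff[OF sym])
  also have "\<dots> = (\<Sum>k\<le>N. \<Sum>l\<le>N. if l = i then (if k = j then A $$ (j, i) else 0) else 0)"
    by (intro sum.cong refl) (use ij in auto)
  also have "\<dots> = A $$ (j, i)" using ij by simp
  finally show ?thesis using sym[of i j] ij by simp
qed

section \<open>The Hessian matrix of a cubic in normal form\<close>

text \<open>The Jacobian matrix of the \<open>C i\<close> with respect to the last \<open>\<tau>\<close> variables at \<open>p\<close>; \<open>j\<close> counts these variables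
  from 0.\<close>

definition jac :: "nat \<Rightarrow> nat \<Rightarrow> (nat \<Rightarrow> 'a::comm_semiring_1 mpoly) \<Rightarrow> 'a vec \<Rightarrow> nat \<Rightarrow> nat \<Rightarrow> 'a" where
  "jac N \<tau> C p i j = eval (pd (N - \<tau> + 1 + j) (C i)) p"

text \<open>The nondegeneracy condition at a single point.\<close>

definition nondegenerate_at :: "nat \<Rightarrow> nat \<Rightarrow> (nat \<Rightarrow> 'a::field mpoly) \<Rightarrow> 'a mpoly \<Rightarrow> 'a vec \<Rightarrow> bool" where
  "nondegenerate_at N \<tau> C D p \<longleftrightarrow>
     vec_space.rank (Suc \<tau>) (mat (Suc \<tau>) \<tau> (\<lambda>(i, j). jac N \<tau> C p i j)) = \<tau> \<and>
     det (mat (N - 2 * \<tau>) (N - 2 * \<tau>)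
       (\<lambda>(i, j). eval (pd (\<tau> + 1 + i) (pd (\<tau> + 1 + j) D)) p)) \<noteq> 0"

lemma nondegenerate_iff: "nondegenerate N \<tau> C D \<longleftrightarrow> for_general N (nondegenerate_at N \<tau> C D)"
  unfolding nondegenerate_def nondegenerate_at_def jac_def ..

lemma sum_shift_lessThan: "(\<Sum>l\<in>{a..<a + n}. g l) = (\<Sum>j<n. g (a + j))"
  for g :: "nat \<Rightarrow> 'a::comm_monoid_add"
  by (induction n) auto

context
  fixes N \<tau> :: nat and f :: "'a::field_char_0 mpoly" and C :: "nat \<Rightarrow> 'a mpoly" and D :: "'a mpoly"
  assumes \<tau>: "\<tau> \<le> N - \<tau>" "1 \<le> \<tau>" and nf: "normal_form N \<tau> f C D"
begin

lemma nf_C: "i \<le> \<tau> \<Longrightarrow> is_form {N - \<tau> + 1..N} 2 (C i)"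
  and nf_D: "is_form {\<tau> + 1..N} 3 D"
  and nf_f: "f = (\<Sum>i\<le>\<tau>. Var i * C i) + D"
  and nf_indep: "(\<Sum>i\<le>\<tau>. Const (c i) * C i) = 0 \<Longrightarrow> i \<le> \<tau> \<Longrightarrow> c i = 0"
  using nf by (auto simp: normal_form_def)

lemma nf_pd_C: "i \<le> \<tau> \<Longrightarrow> j \<le> N - \<tau> \<Longrightarrow> pd j (C i) = 0"
  using nf_C[of i] by (intro pd_eq_0_if_notin_vars) (auto simp: is_form_iff)

lemma nf_pd_D: "j \<le> \<tau> \<Longrightarrow> pd j D = 0"
  using nf_D by (intro pd_eq_0_if_notin_vars) (auto simp: is_form_iff)

lemma nf_pd_f_low: "j \<le> \<tau> \<Longrightarrow> pd j f = C j"
proof -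
  assume j: "j \<le> \<tau>"
  have "pd j (Var i * C i) = (if i = j then C j else 0)" if "i \<le> \<tau>" for i
    using nf_pd_C[OF that, of j] j \<tau> by (auto simp: pd_mult pd_Var)
  then show ?thesis using j by (simp add: nf_f pd_add pd_sum nf_pd_D)
qed

lemma nf_pd_f_mid: "\<tau> < j \<Longrightarrow> j \<le> N - \<tau> \<Longrightarrow> pd j f = pd j D"
  by (simp add: nf_f pd_add pd_sum pd_mult pd_Var nf_pd_C)

lemma nf_block: "i \<le> \<tau> \<Longrightarrow> j \<le> N - \<tau> \<Longrightarrow> pd i (pd j f) = 0"
  by (subst pd_commute) (simp add: nf_pd_f_low nf_pd_C)

lemma nf_vanishing_hessian: "vanishing_hessian N f"
  unfolding vanishing_hessian_def
proof (rule det_eq_0_if_zero_block[where a = "Suc \<tau>" and b = "Suc (N - \<tau>)"])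
  show "hessian N f $$ (i, j) = 0" if "i < Suc \<tau>" "j < Suc (N - \<tau>)" for i j
    using that \<tau> nf_block[of i j] by (simp add: hessian_def)
qed (use \<tau> in \<open>auto simp: hessian_def\<close>)

lemma nf_polar_block: "i \<le> \<tau> \<Longrightarrow> j \<le> N - \<tau> \<Longrightarrow> polar_quadric N f p $$ (i, j) = 0"
  using \<tau> by (simp add: polar_quadric_index nf_block)

text \<open>For \<open>\<tau> = 1\<close>, both \<open>C 0\<close> and \<open>C 1\<close> would be multiples of the square of the last variable.\<close>

lemma nf_tau_ge_2: "2 \<le> \<tau>"
proof (rule ccontr)
  assume "\<not> 2 \<le> \<tau>"
  then have t: "\<tau> = 1" using \<tau> by simp
  let ?m = "Poly_Mapping.single N (2::nat)"
  have key: "m = ?m" if "i \<le> \<tau>" "m \<in> Poly_Mapping.keys (C i)" for i m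
  proof -
    have k: "Poly_Mapping.keys m \<subseteq> {N}" and d: "mdeg m = 2"
      using nf_C[OF that(1)] that(2) t \<tau> by (auto simp: is_form_iff poly_vars_def)
    have "Poly_Mapping.lookup m N = 2" using mdeg_superset[OF _ k] d by simp
    then show ?thesis using k
      by (intro poly_mapping_eqI) (auto simp: lookup_single when_def in_keys_iff subset_iff)
  qed
  define a where "a i = Poly_Mapping.lookup (C i) ?m" for i
  have C: "C i = Poly_Mapping.single ?m (a i)" if "i \<le> \<tau>" for i
    by (rule poly_mapping_eqI) (use key[OF that] in \<open>auto simp: a_def lookup_single when_def in_keys_iff\<close>)
  let ?c = "\<lambda>i. if i = 0 then a 1 else - a 0"
  have "(\<Sum>i\<le>\<tau>. Const (?c i) * C i) = 0"
    using C t by (simp add: Const_mult_single single_add[symmetric])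
  from nf_indep[OF this, of 0] nf_indep[OF this, of 1] have "a 0 = 0" "a 1 = 0" using t by auto
  then have "C 0 = 0" using C by simp
  then have "(\<Sum>i\<le>\<tau>. Const (if i = 0 then 1 else 0) * C i) = 0" by (intro sum.neutral) auto
  from nf_indep[OF this, of 0] show False by simp
qed

lemma nf_N_ge: "4 \<le> N"
  using nf_tau_ge_2 \<tau> by linarith

lemma nf_C0_nonzero: "C 0 \<noteq> 0"
proof
  assume "C 0 = 0"
  then have "(\<Sum>i\<le>\<tau>. Const (if i = 0 then 1 else 0) * C i) = 0" by (intro sum.neutral) auto
  from nf_indep[OF this, of 0] show False by simp
qed

lemma jac_inj:
  assumes nd: "nondegenerate_at N \<tau> C D p" and sol: "\<And>i. i \<le> \<tau> \<Longrightarrow> (\<Sum>j<\<tau>. jac N \<tau> C p i j * x j) = 0"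
  shows "\<forall>j<\<tau>. x j = 0"
proof -
  let ?J = "mat (Suc \<tau>) \<tau> (\<lambda>(i, j). jac N \<tau> C p i j)"
  have J: "?J \<in> carrier_mat (Suc \<tau>) \<tau>" by simp
  have "?J *\<^sub>v vec \<tau> x = 0\<^sub>v (Suc \<tau>)"
  proof (rule eq_vecI)
    fix i assume "i < dim_vec (0\<^sub>v (Suc \<tau>) :: 'a vec)"
    then have i: "i < Suc \<tau>" by simp
    have "(?J *\<^sub>v vec \<tau> x) $ i = (\<Sum>j<\<tau>. ?J $$ (i, j) * vec \<tau> x $ j)"
      by (rule mult_mat_vec_index[OF J _ i]) simp
    also have "\<dots> = (\<Sum>j<\<tau>. jac N \<tau> C p i j * x j)"
      by (rule sum.cong) (use i in auto)
    finally show "(?J *\<^sub>v vec \<tau> x) $ i = 0\<^sub>v (Suc \<tau>) $ i" using sol[of i] i by simp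
  qed simp
  then have "vec \<tau> x = 0\<^sub>v \<tau>" using rank_eq_ncols_iff[OF J] nd vec_carrier[of \<tau> x]
    unfolding nondegenerate_at_def by blast
  then show ?thesis by (auto simp: vec_eq_iff)
qed

lemma sum_last: "(\<Sum>l\<in>{N - \<tau> + 1..N}. g l) = (\<Sum>j<\<tau>. g (N - \<tau> + 1 + j))" for g :: "nat \<Rightarrow> 'a"
proof -
  have "{N - \<tau> + 1..N} = {N - \<tau> + 1..<N - \<tau> + 1 + \<tau>}" using \<tau> by auto
  then show ?thesis by (simp only: sum_shift_lessThan)
qed

lemma sum_mid: "(\<Sum>l\<in>{\<tau> + 1..N - \<tau>}. g l) = (\<Sum>j<N - 2 * \<tau>. g (\<tau> + 1 + j))" for g :: "nat \<Rightarrow> 'a"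
proof -
  have "{\<tau> + 1..N - \<tau>} = {\<tau> + 1..<\<tau> + 1 + (N - 2 * \<tau>)}" using \<tau> by auto
  then show ?thesis by (simp only: sum_shift_lessThan)
qed

text \<open>For a kernel vector of the Hessian matrix, the rows with index at most \<open>\<tau>\<close> show that the last \<open>\<tau>\<close>
  coordinates vanish, and then the middle rows show the same for the middle coordinates.\<close>

lemma nf_kernel_first:
  assumes nd: "nondegenerate_at N \<tau> C D p" and ker: "\<And>i. i \<le> N \<Longrightarrow> (\<Sum>l\<le>N. eval (pd i (pd l f)) p * u l) = 0"
  shows "\<forall>l\<in>{\<tau> + 1..N}. u l = 0"
proof -
  have last: "u l = 0" if l: "l \<in> {N - \<tau> + 1..N}" for l
  proof -
    have "\<forall>j<\<tau>. u (N - \<tau> + 1 + j) = 0"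
    proof (rule jac_inj[OF nd])
      fix i assume i: "i \<le> \<tau>"
      have "(\<Sum>l\<le>N. eval (pd i (pd l f)) p * u l) = (\<Sum>l\<in>{N - \<tau> + 1..N}. eval (pd l (C i)) p * u l)"
        by (rule sum.mono_neutral_cong_right)
          (use i \<tau> nf_block[OF i] nf_pd_f_low[OF i] pd_commute[of i _ f] in auto)
      also have "\<dots> = (\<Sum>j<\<tau>. jac N \<tau> C p i j * u (N - \<tau> + 1 + j))"
        by (simp only: sum_last jac_def)
      finally show "(\<Sum>j<\<tau>. jac N \<tau> C p i j * u (N - \<tau> + 1 + j)) = 0" using ker[of i] i \<tau> by simp
    qed
    moreover have idx: "l - (N - \<tau> + 1) < \<tau>" using l \<tau> by auto
    ultimately have "u (N - \<tau> + 1 + (l - (N - \<tau> + 1))) = 0" using idx by blast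
    then show ?thesis using l by simp
  qed
  have mid: "u l = 0" if l: "l \<in> {\<tau> + 1..N - \<tau>}" for l
  proof -
    let ?H = "mat (N - 2 * \<tau>) (N - 2 * \<tau>) (\<lambda>(i, j). eval (pd (\<tau> + 1 + i) (pd (\<tau> + 1 + j) D)) p)"
    have "\<forall>j<N - 2 * \<tau>. u (\<tau> + 1 + j) = 0"
    proof (rule det_nonzero_inj[of ?H])
      fix i assume i: "i < N - 2 * \<tau>"
      let ?i = "\<tau> + 1 + i"
      have iN: "?i \<le> N - \<tau>" using i \<tau> by linarith
      have "(\<Sum>l\<le>N. eval (pd ?i (pd l f)) p * u l) = (\<Sum>l\<in>{\<tau> + 1..N - \<tau>}. eval (pd ?i (pd l D)) p * u l)"
      proof (rule sum.mono_neutral_cong_right)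
        show "\<forall>l\<in>{..N} - {\<tau> + 1..N - \<tau>}. eval (pd ?i (pd l f)) p * u l = 0"
        proof
          fix l assume l: "l \<in> {..N} - {\<tau> + 1..N - \<tau>}"
          show "eval (pd ?i (pd l f)) p * u l = 0"
          proof (cases "l \<le> \<tau>")
            case True
            then show ?thesis using nf_block[OF True iN] pd_commute[of ?i l f] by simp
          next
            case False
            then show ?thesis using last[of l] l by simp
          qed
        qed
      qed (use nf_pd_f_mid in auto)
      also have "\<dots> = (\<Sum>j<N - 2 * \<tau>. ?H $$ (i, j) * u (\<tau> + 1 + j))"
        unfolding sum_mid by (rule sum.cong) (use i in auto)
      finally show "(\<Sum>j<N - 2 * \<tau>. ?H $$ (i, j) * u (\<tau> + 1 + j)) = 0"
        using ker[of ?i] iN by simp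
    qed (use nd in \<open>auto simp: nondegenerate_at_def\<close>)
    moreover have "l - (\<tau> + 1) < N - 2 * \<tau>" using l by auto
    ultimately have "u (\<tau> + 1 + (l - (\<tau> + 1))) = 0" by blast
    then show ?thesis using l by simp
  qed
  show ?thesis
  proof
    fix l assume "l \<in> {\<tau> + 1..N}"
    then show "u l = 0" using last[of l] mid[of l] by (cases "l \<le> N - \<tau>") auto
  qed
qed

text \<open>The remaining coordinates are a left kernel vector of the Jacobian matrix of the \<open>C i\<close>.\<close>

lemma nf_kernel_trivial:
  assumes nd: "nondegenerate_at N \<tau> C D p" and k: "k \<le> \<tau>" "det (border \<tau> k (jac N \<tau> C p)) \<noteq> 0" "u k = 0"
    and ker: "\<And>i. i \<le> N \<Longrightarrow> (\<Sum>l\<le>N. eval (pd i (pd l f)) p * u l) = 0"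
  shows "\<forall>l\<le>N. u l = 0"
proof -
  have first: "\<forall>l\<in>{\<tau> + 1..N}. u l = 0" by (rule nf_kernel_first[OF nd ker])
  have "\<forall>l\<le>\<tau>. u l = 0"
  proof (rule border_det_nonzero_left[where k = k and J = "jac N \<tau> C p"])
    show "det (border \<tau> k (jac N \<tau> C p)) \<noteq> 0" "k \<le> \<tau>" "u k = 0" by (fact k)+
    fix j assume j: "j < \<tau>"
    let ?i = "N - \<tau> + 1 + j"
    have "(\<Sum>l\<le>N. eval (pd ?i (pd l f)) p * u l) = (\<Sum>l\<le>\<tau>. u l * jac N \<tau> C p l j)"
      by (rule sum.mono_neutral_cong_right) (use first nf_pd_f_low \<tau> in \<open>auto simp: jac_def\<close>)
    then show "(\<Sum>l\<le>\<tau>. u l * jac N \<tau> C p l j) = 0" using ker[of ?i] j \<tau> by simp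
  qed
  with first show ?thesis by (metis Suc_eq_plus1 atLeastAtMost_iff not_less_eq_eq)
qed

lemma nf_ex_border:
  assumes "nondegenerate_at N \<tau> C D p"
  shows "\<exists>k\<le>\<tau>. det (border \<tau> k (jac N \<tau> C p)) \<noteq> 0"
  by (rule ex_border_det_nonzero) (use jac_inj[OF assms] in blast)

lemma nf_generator:
  assumes nd: "nondegenerate_at N \<tau> C D p"
  shows "generator N (polar_quadric N f p) (zeros N (Var ` {\<tau> + 1..N}))"
proof -
  let ?A = "polar_quadric N f p"
  let ?M = "zeros N (Var ` {\<tau> + 1..N}) :: 'a vec set"
  obtain k where k: "k \<le> \<tau>" "det (border \<tau> k (jac N \<tau> C p)) \<noteq> 0" using nf_ex_border[OF nd] by blast
  have kN: "k \<le> N" using k \<tau> by simp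
  \<comment> \<open>Three columns with index different from \<open>k\<close> exist because of \<open>N \<ge> 4\<close>.\<close>
  have "3 \<le> vec_space.rank (Suc N) ?A"
  proof (rule rank_ge_if_indpt_cols[where \<sigma> = "\<lambda>j. if j < k then j else Suc j"])
    show "inj_on (\<lambda>j. if j < k then j else Suc j) {..<3}" by (auto simp: inj_on_def split: if_splits)
    show "(\<lambda>j. if j < k then j else Suc j) ` {..<3} \<subseteq> {..<Suc N}" using nf_N_ge by auto
    fix x assume ker: "\<And>i. i < Suc N \<Longrightarrow> (\<Sum>j<Suc N. ?A $$ (i, j) * x j) = 0"
      and x: "\<And>j. j \<notin> (\<lambda>j. if j < k then j else Suc j) ` {..<3} \<Longrightarrow> x j = 0"
    have "x k = 0" by (rule x) auto
    moreover have "(\<Sum>l\<le>N. eval (pd i (pd l f)) p * x l) = 0" if "i \<le> N" for i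
    proof -
      have "(\<Sum>l\<le>N. eval (pd i (pd l f)) p * x l) = (\<Sum>j<Suc N. ?A $$ (i, j) * x j)"
        using that by (intro sum.cong) (auto simp: polar_quadric_index)
      then show ?thesis using ker[of i] that by simp
    qed
    ultimately have "\<forall>l\<le>N. x l = 0" by (rule nf_kernel_trivial[OF nd k])
    then show "\<forall>j<Suc N. x j = 0" by (simp add: less_Suc_eq_le)
  qed simp
  moreover have ex: "\<exists>a\<ge>1. linear_space N a ?M"
    by (intro exI[of _ \<tau>] conjI linear_space_coordinates) (use \<tau> in auto)
  moreover have "?M \<subseteq> quadric N ?A"
    by (rule zero_block_tangent(1)) (use \<tau> polar_quadric_sym nf_polar_block in auto)
  moreover have "Vert N ?A \<subset> ?M"
  proof -
    have Vert: "v \<in> Vert N ?A \<longleftrightarrow> v \<in> proj_space N \<and> (\<forall>i\<le>N. (\<Sum>j\<le>N. eval (pd i (pd j f)) p * v $ j) = 0)" for v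
    proof -
      have "(\<Sum>j\<le>N. ?A $$ (i, j) * v $ j) = (\<Sum>j\<le>N. eval (pd i (pd j f)) p * v $ j)" if "i \<le> N" for i
        using that by (intro sum.cong) (auto simp: polar_quadric_index)
      then show ?thesis by (subst Vert_iff) (auto simp: polar_quadric_sym)
    qed
    have "Vert N ?A \<subseteq> ?M"
    proof
      fix v assume v: "v \<in> Vert N ?A"
      then have "\<forall>l\<in>{\<tau> + 1..N}. v $ l = 0" using Vert by (intro nf_kernel_first[OF nd]) auto
      then show "v \<in> ?M" using v Vert by (simp add: coordinate_space_iff)
    qed
    \<comment> \<open>A coordinate point of \<open>M\<close> whose coordinate with index \<open>k\<close> is zero is not in the vertex.\<close>
    moreover define i where "i = (if k = 0 then 1 else 0 :: nat)"
    have i: "i \<le> \<tau>" "i \<noteq> k" "i \<le> N" using \<tau> by (auto simp: i_def)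
    have "unit_vec (Suc N) i \<in> ?M"
      using i by (auto simp: coordinate_space_iff proj_space_iff intro!: exI[of _ i])
    moreover have "unit_vec (Suc N) i \<notin> Vert N ?A"
    proof
      assume "unit_vec (Suc N) i \<in> Vert N ?A"
      then have "\<forall>l\<le>N. (unit_vec (Suc N) i :: 'a vec) $ l = 0"
        using Vert kN i by (intro nf_kernel_trivial[OF nd k]) auto
      then show False using i by auto
    qed
    ultimately show ?thesis by blast
  qed
  ultimately show ?thesis unfolding generator_def by blast
qed

end

lemma psubst_cong: "poly_vars g \<subseteq> I \<Longrightarrow> (\<And>i. i \<in> I \<Longrightarrow> \<phi> i = \<psi> i) \<Longrightarrow> psubst \<kappa> \<phi> g = psubst \<kappa> \<psi> g"
  unfolding psubst_def mon_eval_def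
  by (intro sum.cong prod.cong arg_cong2[where f = "(*)"] refl) (auto simp: poly_vars_def subset_iff)

lemma nf_codim:
  fixes f :: "'a::{alg_closed_field, field_char_0} mpoly"
  assumes \<tau>: "\<tau> \<le> N - \<tau>" "1 \<le> \<tau>" and nf: "normal_form N \<tau> f C D"
    and f: "is_form {..N} 3 f" and nd: "nondegenerate N \<tau> C D"
  shows "codim N (polar_image N f) = 1"
proof -
  note nfs = \<tau> nf
  obtain s d p0 where s: "is_form {..N} d s" "p0 \<in> proj_space N" "eval s p0 \<noteq> 0"
    and nd_at: "\<And>p. p \<in> proj_space N \<Longrightarrow> eval s p \<noteq> 0 \<Longrightarrow> nondegenerate_at N \<tau> C D p"
    using nd unfolding nondegenerate_iff for_general_iff by blast
  obtain k where k: "k \<le> \<tau>" "det (border \<tau> k (jac N \<tau> C p0)) \<noteq> 0"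
    using nf_ex_border[OF nfs nd_at[OF s(2,3)]] by blast
  \<comment> \<open>The condition that singles out \<open>k\<close> is open: it is the nonvanishing of a polynomial \<open>b\<close>.\<close>
  define b where "b = det (border \<tau> k (\<lambda>i j. pd (N - \<tau> + 1 + j) (C i)))"
  have eval_b: "eval b p = det (border \<tau> k (jac N \<tau> C p))" for p
  proof -
    have "det (border \<tau> k (jac N \<tau> C p)) = det (map_mat (\<lambda>g. eval g p) (border \<tau> k (\<lambda>i j. pd (N - \<tau> + 1 + j) (C i))))"
      by (rule arg_cong[where f = det], rule eq_matI) (auto simp: border_def jac_def)
    then show ?thesis by (simp add: b_def)
  qed
  have b_vars: "poly_vars b \<subseteq> {..N}"
  proof -
    have "b \<in> {c. poly_vars c \<subseteq> {..N}}"
      unfolding b_def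
    proof (rule det_in_subring[OF subring_set_vars border_carrier])
      fix i j assume "i < Suc \<tau>" "j < Suc \<tau>"
      then show "border \<tau> k (\<lambda>i j. pd (N - \<tau> + 1 + j) (C i)) $$ (i, j) \<in> {c. poly_vars c \<subseteq> {..N}}"
        using is_form_vars[OF is_form_mono[OF nf_C[OF nfs, of i]], of N]
          poly_vars_pd[of "N - \<tau> + 1 + j" "C i"]
        by (auto simp: border_def)
    qed
    then show ?thesis by simp
  qed
  have sb_vars: "poly_vars (s * b) \<subseteq> {..N}"
    using poly_vars_mult[of s b] b_vars is_form_vars[OF s(1)] by blast
  obtain G where G: "G \<noteq> 0" "poly_vars G \<subseteq> {..\<tau>}" "psubst Const C G = 0"
    using ex_algebraic_relation[of "{N - \<tau> + 1..N}" \<tau> 2 C] nf_C[OF nfs] \<tau> by auto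
  have "psubst Const (\<lambda>i. pd i f) G = psubst Const C G"
    by (rule psubst_cong[OF G(2)]) (simp add: nf_pd_f_low[OF nfs])
  then have G0: "psubst Const (\<lambda>i. pd i f) G = 0" using G by simp
  show ?thesis
  proof (rule codim_polar_image_eq_1[OF f, where l = 0 and k = k and s = "s * b" and q = p0])
    show "pd 0 f \<noteq> 0" using nf_pd_f_low[OF nfs, of 0] nf_C0_nonzero[OF nfs] by simp
    show "k \<le> N" using k \<tau> by simp
    show "p0 \<in> carrier_vec (Suc N)" using s by (simp add: proj_space_def)
    show "eval (s * b) p0 \<noteq> 0" using s k by (simp add: eval.hom_mult eval_b)
    show "poly_vars G \<subseteq> {..N}" using G \<tau> by auto
    show "poly_vars (s * b) \<subseteq> {..N}" by (rule sb_vars)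
    show "psubst Const (\<lambda>i. pd i f) G = 0" by (rule G0)
    show "G \<noteq> 0" by (rule G)
    show "(0::nat) \<le> N" by simp
    fix p u assume p: "p \<in> proj_space N" "eval (s * b) p \<noteq> 0"
      and ker: "\<And>j. j \<le> N \<Longrightarrow> (\<Sum>i\<le>N. u i * eval (pd j (pd i f)) p) = 0" and uk: "u k = 0"
    have "eval s p \<noteq> 0" "det (border \<tau> k (jac N \<tau> C p)) \<noteq> 0"
      using p(2) by (auto simp: eval.hom_mult eval_b)
    from nf_kernel_trivial[where u = u, OF nfs nd_at[OF p(1) this(1)] k(1) this(2) uk] ker
    show "\<forall>i\<le>N. u i = 0" by (simp add: mult.commute)
  qed
qed

section \<open>From a block of zeros to the normal form\<close>

text \<open>The vanishing of the second derivatives gives the shape of \<open>f\<close>; that \<open>V(f)\<close> is not a cone is used for the linear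
  independence of the \<open>C i\<close> only.\<close>

lemma ex_normal_form:
  fixes f :: "'a::field_char_0 mpoly"
  assumes \<tau>: "\<tau> \<le> N - \<tau>" and f: "is_form {..N} 3 f"
    and block: "\<And>i j. i \<le> \<tau> \<Longrightarrow> j \<le> N - \<tau> \<Longrightarrow> pd i (pd j f) = 0"
    and not_cone: "\<not> is_cone N (zeros N {f})"
  shows "\<exists>C D. normal_form N \<tau> f C D"
proof -
  define C where "C i = pd i f" for i
  define D where "D = f - (\<Sum>i\<le>\<tau>. Var i * C i)"
  have fv: "poly_vars (pd i f) \<subseteq> {..N}" for i
    using is_form_vars[OF f] poly_vars_pd[of i f] by blast
  have C: "is_form {N - \<tau> + 1..N} 2 (C i)" if i: "i \<le> \<tau>" for i
  proof -
    have "j \<notin> poly_vars (C i)" if "j \<le> N - \<tau>" for j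
      unfolding C_def using block[OF i that] pd_commute[of i j f] by (intro notin_vars_if_pd_eq_0) simp
    then have "poly_vars (C i) \<subseteq> {N - \<tau> + 1..N}"
      using fv[of i] by (force simp: C_def not_le Suc_le_eq)
    moreover have "is_form {..N} 2 (C i)"
      unfolding C_def by (rule is_form_pd) (use f in \<open>simp add: numeral_3_eq_3 numeral_2_eq_2\<close>)
    ultimately show ?thesis by (simp add: is_form_iff)
  qed
  have D3: "is_form {..N} 3 D"
  proof -
    have "is_form {..N} (1 + 2) (Var i * C i)" if "i \<le> \<tau>" for i
    proof (rule is_form_mult)
      show "is_form {..N} 1 (Var i :: 'a mpoly)" by (rule is_form_Var) (use that \<tau> in simp)
      show "is_form {..N} 2 (C i)" by (rule is_form_mono[OF C[OF that]]) auto
    qed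
    then have "is_form {..N} 3 (\<Sum>i\<le>\<tau>. Var i * C i)" by (intro is_form_sum) (simp add: numeral_3_eq_3 numeral_2_eq_2)
    then show ?thesis unfolding D_def by (rule is_form_diff[OF f])
  qed
  have "j \<notin> poly_vars D" if j: "j \<le> \<tau>" for j
  proof (rule notin_vars_if_pd_eq_0)
    have "pd j (Var i * C i) = (if i = j then C j else 0)" if "i \<le> \<tau>" for i
      using block[of i j] j \<tau> that pd_commute[of i j f] by (auto simp: pd_mult pd_Var C_def)
    then show "pd j D = 0" using j by (simp add: D_def pd_diff pd_sum C_def)
  qed
  then have D: "is_form {\<tau> + 1..N} 3 D"
    using D3 by (force simp: is_form_iff not_le Suc_le_eq)
  have fCD: "f = (\<Sum>i\<le>\<tau>. Var i * C i) + D" by (simp add: D_def)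
  have eval_f: "eval f v = (\<Sum>i\<le>\<tau>. v $ i * eval (C i) v) + eval D v" for v
    by (subst fCD) (simp add: eval.hom_add eval.hom_sum eval.hom_mult)
  have indep: "c i = 0" if c: "(\<Sum>i\<le>\<tau>. Const (c i) * C i) = 0" and i: "i \<le> \<tau>" for c i
  proof (rule ccontr)
    assume ci: "c i \<noteq> 0"
    define p where "p = vec (Suc N) (\<lambda>j. if j \<le> \<tau> then c j else 0)"
    have p: "p \<in> proj_space N"
      using ci i \<tau> by (auto simp: p_def proj_space_iff intro!: exI[of _ i])
    \<comment> \<open>The forms \<open>C j\<close> and \<open>D\<close> do not contain the variables in which \<open>p\<close> has coordinates, and the summand linear in \<open>a\<close> is the assumed relation.\<close>
    have line: "eval f (a \<cdot>\<^sub>v p + b \<cdot>\<^sub>v q) = b ^ 3 * eval f q" if q: "q \<in> carrier_vec (Suc N)" for a b q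
    proof -
      let ?v = "a \<cdot>\<^sub>v p + b \<cdot>\<^sub>v q" and ?w = "b \<cdot>\<^sub>v q"
      have high: "?v $ j = ?w $ j" if "j \<in> {\<tau> + 1..N}" for j
        using that q by (simp add: p_def)
      have evC: "eval (C j) ?v = eval (C j) ?w" if "j \<le> \<tau>" for j
        by (rule eval_cong[where I = "{N - \<tau> + 1..N}"]) (use C[OF that] high \<tau> in \<open>auto simp: is_form_iff\<close>)
      have evD: "eval D ?v = eval D ?w"
        by (rule eval_cong[where I = "{\<tau> + 1..N}"]) (use D high in \<open>auto simp: is_form_iff\<close>)
      have "eval f ?v = (\<Sum>j\<le>\<tau>. (a * c j + ?w $ j) * eval (C j) ?w) + eval D ?w"
        unfolding eval_f evD
        by (intro arg_cong2[where f = "(+)"] sum.cong refl) (use evC q \<tau> in \<open>auto simp: p_def\<close>)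
      also have "\<dots> = a * eval (\<Sum>j\<le>\<tau>. Const (c j) * C j) ?w + eval f ?w"
        by (simp add: eval_f eval.hom_sum eval.hom_mult distrib_right sum.distrib sum_distrib_left mult.assoc)
      finally show ?thesis using c eval_form_smult[OF f q] by simp
    qed
    have "1 \<cdot>\<^sub>v p + 0 \<cdot>\<^sub>v p = p" using p by (auto simp: proj_space_def)
    then have "eval f p = 0" using line[of p 1 0] p by (simp add: proj_space_def)
    then have "is_cone N (zeros N {f})"
      unfolding is_cone_def using p line
      by (intro bexI[of _ p]) (auto simp: zeros_def line_def proj_space_def)
    with not_cone show False by simp
  qed
  have "normal_form N \<tau> f C D"
    unfolding normal_form_def using C D fCD indep by blast
  then show ?thesis by blast
qed

section \<open>Tangency along a common generator\<close>

theorem theorem3p6: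
  fixes N \<tau> :: nat and M L :: "'a::{alg_closed_field, field_char_0} vec set"
  assumes "1 \<le> \<tau>" and "\<tau> \<le> N - \<tau>"
    and M: "M = zeros N (Var ` {\<tau> + 1..N})"
    and L: "L = zeros N (Var ` {N - \<tau> + 1..N})"
  shows
    "(\<forall>f :: 'a mpoly.
        cubic_hypersurface N f \<and> vanishing_hessian N f \<and> \<not> is_cone N (zeros N {f}) \<and>
        codim N (polar_image N f) = 1 \<and>
        for_general N (\<lambda>p.
          generator N (polar_quadric N f p) M \<and>
          tangent_along N (polar_quadric N f p) L M \<and>
          L = (\<Inter>m \<in> M - Vert N (polar_quadric N f p).
                 quadric_tangent_space N (polar_quadric N f p) m))
        \<longrightarrow> (\<exists>C D. normal_form N \<tau> f C D))
     \<and>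
     (\<forall>(f :: 'a mpoly) C D.
        cubic_hypersurface N f \<and> normal_form N \<tau> f C D
        \<longrightarrow> vanishing_hessian N f \<and>
            for_general N (\<lambda>p.
              M \<subseteq> quadric N (polar_quadric N f p) \<and>
              tangent_along N (polar_quadric N f p) L M) \<and>
            (nondegenerate N \<tau> C D
             \<longrightarrow> for_general N (\<lambda>p.
                   generator N (polar_quadric N f p) M \<and>
                   tangent_along N (polar_quadric N f p) L M) \<and>
                 codim N (polar_image N f) = 1))"
proof (intro conjI allI impI)
  fix f :: "'a mpoly"
  assume A: "cubic_hypersurface N f \<and> vanishing_hessian N f \<and> \<not> is_cone N (zeros N {f}) \<and>
        codim N (polar_image N f) = 1 \<and>
        for_general N (\<lambda>p.
          generator N (polar_quadric N f p) M \<and>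
          tangent_along N (polar_quadric N f p) L M \<and>
          L = (\<Inter>m \<in> M - Vert N (polar_quadric N f p).
                 quadric_tangent_space N (polar_quadric N f p) m))"
  then have f: "is_form {..N} 3 f" by (simp add: cubic_hypersurface_def)
  obtain s d p0 where s: "is_form {..N} d s" "p0 \<in> proj_space N" "eval s p0 \<noteq> 0"
    and tang: "\<And>p. p \<in> proj_space N \<Longrightarrow> eval s p \<noteq> 0 \<Longrightarrow> tangent_along N (polar_quadric N f p) L M"
    using A unfolding for_general_iff by blast
  have "pd i (pd j f) = 0" if ij: "i \<le> \<tau>" "j \<le> N - \<tau>" for i j
  proof (rule eval_generic_eq_0[OF is_form_vars[OF s(1)] _ s(3)])
    show "p0 \<in> carrier_vec (Suc N)" using s by (simp add: proj_space_def)
    show "poly_vars (pd i (pd j f)) \<subseteq> {..N}"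
      using is_form_vars[OF f] poly_vars_pd[of i "pd j f"] poly_vars_pd[of j f] by blast
    fix q assume q: "q \<in> proj_space N" "eval s q \<noteq> 0"
    have "polar_quadric N f q $$ (i, j) = 0"
      by (rule tangent_zero_block[OF _ tang[OF q, unfolded L M]]) (use ij assms polar_quadric_sym in auto)
    then show "eval (pd i (pd j f)) q = 0" using ij assms by (simp add: polar_quadric_index)
  qed
  then show "\<exists>C D. normal_form N \<tau> f C D"
    using ex_normal_form[OF assms(2) f] A by blast
next
  fix f D :: "'a mpoly" and C assume A: "cubic_hypersurface N f \<and> normal_form N \<tau> f C D"
  then have nf: "normal_form N \<tau> f C D" and f: "is_form {..N} 3 f" by (auto simp: cubic_hypersurface_def)
  note nfs = assms(2,1) nf
  show "vanishing_hessian N f" by (rule nf_vanishing_hessian[OF nfs])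
  have tang: "M \<subseteq> quadric N (polar_quadric N f p) \<and> tangent_along N (polar_quadric N f p) L M" for p
    unfolding M L using zero_block_tangent[OF assms(2), of "polar_quadric N f p"]
      polar_quadric_sym nf_polar_block[OF nfs] by blast
  show "for_general N (\<lambda>p. M \<subseteq> quadric N (polar_quadric N f p) \<and> tangent_along N (polar_quadric N f p) L M)"
    using tang by (intro for_general_all)
  assume nd: "nondegenerate N \<tau> C D"
  show "codim N (polar_image N f) = 1" by (rule nf_codim[OF nfs f nd])
  show "for_general N (\<lambda>p. generator N (polar_quadric N f p) M \<and> tangent_along N (polar_quadric N f p) L M)"
    using nd[unfolded nondegenerate_iff]
    by (rule for_general_mono) (use tang nf_generator[OF nfs] M in blast)
qed

end
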